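(* For every integer $t\geq0$, the graph $\widehat B_t^\star$ is connected, subcubic, and noncubic, and satisfies $$|V(\widehat B_t^\star)|=76\cdot2^t-12,\qquad \gamma(\widehat B_t^\star)=26\cdot2^t-4,\qquad \rho(\widehat B_t^\star)=12\cdot2^t-2.$$ Consequently, $$\gamma(\widehat B_t^\star)-2\rho(\widehat B_t^\star)=2^{t+1},$$ and $$\frac{\gamma(\widehat B_t^\star)}{\rho(\widehat B_t^\star)}=\frac{13}{6}+\frac{1}{36\cdot2^t-6}\xrightarrow[t\to\infty]{}\frac{13}{6}.$$
   Context: All graphs are finite, simple and undirected. Subcubic means maximum degree at most $3$; cubic means every vertex has degree $3$; noncubic means not cubic. $\gamma(G)$ is the domination number (minimum size of $D\subseteq V(G)$ meeting every closed neighborhood). $\rho(G)$ is the packing number (maximum size of a set of vertices pairwise at distance at least $3$). A rooted graph $(H,x)$ is a graph $H$ with a distinguished vertex $x$. Operations on vertex-disjoint rooted graphs (when the same graph occurs twice, take disjoint copies): - Pendant-root extension $(H^\uparrow,p)$: add a new vertex $p$ and the edge $px$; the new root is $p$. - Rooted join $(H\odot K,r)$ of $(H,x)$ and $(K,y)$: identify $x$ and $y$ to a common root $r$. - $H^{\Join}:=H^\uparrow\odot H^\uparrow$. - $H^{\ltimes}:=(H^\uparrow\odot K_1^\uparrow)^\uparrow$, where $K_1$ is rooted at its unique vertex (so $K_1^\uparrow$ is $K_2$ rooted at an endpoint). - Connector composition: for a connected rooted graph $(K,y)$ with an ordered pair $(z_1,z_2)$ of distinct vertices of $V(K)\setminus\{y\}$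 (child ports), and rooted graphs $(H_1,x_1),(H_2,x_2)$, all vertex-disjoint, $(H_1\circledast_K H_2,y)$ is the rooted graph obtained from the disjoint union of $K,H_1,H_2$ by adding the edges $z_1x_1$ and $z_2x_2$; its root is $y$. - Closure: $\widehat H$ is the unrooted graph obtained from two disjoint copies $(H_L,x_L),(H_R,x_R)$ of $(H,x)$ by adding the edge $x_Lx_R$. The seed $(B,b)$: $B$ is the graph obtained from the cycle $b_1b_2\cdots b_9b_1$ by adding the edges $b_2b_6,\ b_3b_8,\ b_4b_7,\ b_5b_9$; its root is $b=b_1$. The connector $A$: the graph obtained from the cycle $a_1a_2a_3a_4a_5a_1$ by adding a vertex $a_6$ and the edges $a_3a_6,\ a_5a_6$; root $a=a_1$, ordered child ports $(a_4,a_6)$. Define rooted graphs $B_0^\star:=((B^{\Join})^\uparrow)^\uparrow\odot B^{\ltimes}$ and $B_{t+1}^\star:=B_t^\star\circledast_A B_t^\star$ for $t\ge0$. $\widehat B_t^\star$ is the closure of $B_t^\star$. *)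

theory Defs
  imports "HOL-Analysis.Analysis" "Graph_Theory.Graph_Theory"
begin

section \<open>Finite simple graphs\<close>

text \<open>
  Following the Graph-Theory library, a finite simple undirected graph is a \<open>pair_graph\<close>:
  a finite symmetric loop-free set of arcs, the undirected edge \<open>uv\<close> being the two arcs
  \<open>(u, v)\<close> and \<open>(v, u)\<close>. Hence the degree of a vertex is its out-degree.
\<close>

definition subcubic :: "'a pair_pre_digraph \<Rightarrow> bool" where
  "subcubic G \<longleftrightarrow> (\<forall>v \<in> pverts G. out_degree (with_proj G) v \<le> 3)"

definition cubic :: "'a pair_pre_digraph \<Rightarrow> bool" where
  "cubic G \<longleftrightarrow> (\<forall>v \<in> pverts G. out_degree (with_proj G) v = 3)"

definition closed_nbhd :: "'a pair_pre_digraph \<Rightarrow> 'a \<Rightarrow> 'a set" where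
  "closed_nbhd G v = insert v {u. (v, u) \<in> parcs G}"

definition dominating_set :: "'a pair_pre_digraph \<Rightarrow> 'a set \<Rightarrow> bool" where
  "dominating_set G D \<longleftrightarrow> D \<subseteq> pverts G \<and> (\<forall>v \<in> pverts G. D \<inter> closed_nbhd G v \<noteq> {})"

definition domination_number :: "'a pair_pre_digraph \<Rightarrow> nat" where
  "domination_number G = Min (card ` {D. dominating_set G D})"

text \<open>
  The graph distance is the library's shortest-path distance for unit arc weights; it is
  \<open>\<infinity>\<close> between vertices of different components.
\<close>

definition graph_dist :: "'a pair_pre_digraph \<Rightarrow> 'a \<Rightarrow> 'a \<Rightarrow> ereal" where
  "graph_dist G u v = wf_digraph.\<mu> (with_proj G) (\<lambda>_. 1) u v"

definition packing_set :: "'a pair_pre_digraph \<Rightarrow> 'a set \<Rightarrow> bool" where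
  "packing_set G P \<longleftrightarrow>
     P \<subseteq> pverts G \<and> (\<forall>u \<in> P. \<forall>v \<in> P. u \<noteq> v \<longrightarrow> graph_dist G u v \<ge> 3)"

definition packing_number :: "'a pair_pre_digraph \<Rightarrow> nat" where
  "packing_number G = Max (card ` {P. packing_set G P})"


section \<open>Rooted graphs and their operations\<close>

text \<open>
  All graphs live on one vertex type. Disjoint copies are made by tagging: \<open>Copy i v\<close> is the
  vertex corresponding to \<open>v\<close> in the copy with index \<open>i\<close>, and \<open>Atom\<close> names the vertices of the
  explicitly given graphs as well as newly created roots. Thus every operation can be applied
  to arbitrary arguments, equal or not.
\<close>

datatype vertex = Atom nat | Copy nat vertex

record rooted_graph =
  graph_of :: "vertex pair_pre_digraph"
  root_of :: vertex

record connector = rooted_graph +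
  port1 :: vertex
  port2 :: vertex

definition rooted :: "'b rooted_graph_scheme \<Rightarrow> bool" where
  "rooted H \<longleftrightarrow> pair_graph (graph_of H) \<and> root_of H \<in> pverts (graph_of H)"

definition is_connector :: "connector \<Rightarrow> bool" where
  "is_connector K \<longleftrightarrow> rooted K \<and> Digraph_Component.connected (with_proj (graph_of K)) \<and>
     {port1 K, port2 K} \<subseteq> pverts (graph_of K) - {root_of K} \<and> port1 K \<noteq> port2 K"

definition map_graph :: "('a \<Rightarrow> 'b) \<Rightarrow> 'a pair_pre_digraph \<Rightarrow> 'b pair_pre_digraph" where
  "map_graph f G = \<lparr>pverts = f ` pverts G, parcs = map_prod f f ` parcs G\<rparr>"

definition graph_union ::
  "'a pair_pre_digraph \<Rightarrow> 'a pair_pre_digraph \<Rightarrow> 'a pair_pre_digraph" where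
  "graph_union G H = \<lparr>pverts = pverts G \<union> pverts H, parcs = parcs G \<union> parcs H\<rparr>"

definition edge_graph :: "('a \<times> 'a) set \<Rightarrow> 'a pair_pre_digraph" where
  "edge_graph E = \<lparr>pverts = fst ` E \<union> snd ` E, parcs = E \<union> E\<inverse>\<rparr>"

definition add_edge :: "'a \<Rightarrow> 'a \<Rightarrow> 'a pair_pre_digraph \<Rightarrow> 'a pair_pre_digraph" where
  "add_edge u v G = graph_union G (edge_graph {(u, v)})"

definition K1 :: rooted_graph where
  "K1 = \<lparr>graph_of = \<lparr>pverts = {Atom 0}, parcs = {}\<rparr>, root_of = Atom 0\<rparr>"

definition pendant :: "rooted_graph \<Rightarrow> rooted_graph" (\<open>_\<^sup>\<up>\<close> [1000] 999) where
  "H\<^sup>\<up> = \<lparr>graph_of = add_edge (Atom 0) (Copy 0 (root_of H)) (map_graph (Copy 0) (graph_of H)),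
          root_of = Atom 0\<rparr>"

text \<open>In a rooted join both roots are sent to the common new root \<open>Atom 0\<close>.\<close>

definition join_map :: "nat \<Rightarrow> rooted_graph \<Rightarrow> vertex \<Rightarrow> vertex" where
  "join_map i H v = (if v = root_of H then Atom 0 else Copy i v)"

definition rooted_join :: "rooted_graph \<Rightarrow> rooted_graph \<Rightarrow> rooted_graph" (infixl \<open>\<odot>\<close> 70) where
  "H \<odot> K = \<lparr>graph_of = graph_union (map_graph (join_map 1 H) (graph_of H))
                                  (map_graph (join_map 2 K) (graph_of K)),
            root_of = Atom 0\<rparr>"

definition bowtie :: "rooted_graph \<Rightarrow> rooted_graph" (\<open>_\<^sup>\<bowtie>\<close> [1000] 999) where
  "H\<^sup>\<bowtie> = H\<^sup>\<up> \<odot> H\<^sup>\<up>"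

definition ltimes :: "rooted_graph \<Rightarrow> rooted_graph" (\<open>_\<^sup>\<ltimes>\<close> [1000] 999) where
  "H\<^sup>\<ltimes> = (H\<^sup>\<up> \<odot> K1\<^sup>\<up>)\<^sup>\<up>"

definition compose :: "connector \<Rightarrow> rooted_graph \<Rightarrow> rooted_graph \<Rightarrow> rooted_graph" where
  "compose K H1 H2 =
     \<lparr>graph_of =
        add_edge (Copy 0 (port1 K)) (Copy 1 (root_of H1))
          (add_edge (Copy 0 (port2 K)) (Copy 2 (root_of H2))
            (graph_union (map_graph (Copy 0) (graph_of K))
              (graph_union (map_graph (Copy 1) (graph_of H1))
                           (map_graph (Copy 2) (graph_of H2))))),
      root_of = Copy 0 (root_of K)\<rparr>"

definition closure_graph :: "rooted_graph \<Rightarrow> vertex pair_pre_digraph" where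
  "closure_graph H =
     add_edge (Copy 1 (root_of H)) (Copy 2 (root_of H))
       (graph_union (map_graph (Copy 1) (graph_of H)) (map_graph (Copy 2) (graph_of H)))"


section \<open>The seed, the connector, and the recursive family\<close>

definition seed_B :: rooted_graph where
  "seed_B = \<lparr>graph_of = map_graph Atom (edge_graph
      ({(1,2), (2,3), (3,4), (4,5), (5,6), (6,7), (7,8), (8,9), (9,1)}
       \<union> {(2,6), (3,8), (4,7), (5,9)})),
     root_of = Atom 1\<rparr>"

definition connector_A :: connector where
  "connector_A = \<lparr>graph_of = map_graph Atom (edge_graph
      ({(1,2), (2,3), (3,4), (4,5), (5,1)} \<union> {(3,6), (5,6)})),
     root_of = Atom 1, port1 = Atom 4, port2 = Atom 6\<rparr>"

primrec Bstar :: "nat \<Rightarrow> rooted_graph" where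
  "Bstar 0 = ((seed_B\<^sup>\<bowtie>)\<^sup>\<up>)\<^sup>\<up> \<odot> seed_B\<^sup>\<ltimes>"
| "Bstar (Suc t) = compose connector_A (Bstar t) (Bstar t)"

definition Bhat :: "nat \<Rightarrow> vertex pair_pre_digraph" where
  "Bhat t = closure_graph (Bstar t)"


section \<open>Well-formedness of the constructions\<close>

lemma pair_graph_iff:
  "pair_graph G \<longleftrightarrow> finite (pverts G) \<and> parcs G \<subseteq> pverts G \<times> pverts G \<and> sym (parcs G)
     \<and> (\<forall>v. (v, v) \<notin> parcs G)"
proof
  assume "pair_graph G"
  then interpret pair_graph G .
  have "parcs G \<subseteq> pverts G \<times> pverts G"
    using in_arcsD1 in_arcsD2 by auto
  moreover have "sym (parcs G)"
    using arcs_symmetric by (auto intro: symI)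
  moreover have "\<forall>v. (v, v) \<notin> parcs G"
    using no_loops' by blast
  ultimately show "finite (pverts G) \<and> parcs G \<subseteq> pverts G \<times> pverts G \<and> sym (parcs G)
     \<and> (\<forall>v. (v, v) \<notin> parcs G)"
    using pair_finite_verts by simp
next
  assume *: "finite (pverts G) \<and> parcs G \<subseteq> pverts G \<times> pverts G \<and> sym (parcs G)
     \<and> (\<forall>v. (v, v) \<notin> parcs G)"
  then have "finite (parcs G)"
    by (meson finite_SigmaI finite_subset)
  with * show "pair_graph G"
    by unfold_locales (auto simp: symmetric_def)
qed

lemma graph_dist_eq_INF_length:
  assumes "pair_graph G"
  shows "graph_dist G u v = (INF p \<in> {p. pre_digraph.awalk (with_proj G) u p v}. ereal (length p))"
proof -
  interpret pair_graph G by fact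
  have "awalk_cost (\<lambda>_. 1) p = length p" for p
    by (induction p) simp_all
  then show ?thesis
    by (simp add: graph_dist_def \<mu>_def)
qed

lemma pair_graph_map_graph: "pair_graph G \<Longrightarrow> inj_on f (pverts G) \<Longrightarrow> pair_graph (map_graph f G)"
  unfolding pair_graph_iff map_graph_def sym_def by (fastforce dest: inj_onD)

lemma pair_graph_union: "pair_graph G \<Longrightarrow> pair_graph H \<Longrightarrow> pair_graph (graph_union G H)"
  unfolding pair_graph_iff graph_union_def sym_def by auto

lemma pair_graph_edge_graph:
  "finite E \<Longrightarrow> (\<And>v. (v, v) \<notin> E) \<Longrightarrow> pair_graph (edge_graph E)"
  unfolding pair_graph_iff edge_graph_def sym_def by force

lemma pair_graph_add_edge: "pair_graph G \<Longrightarrow> u \<noteq> v \<Longrightarrow> pair_graph (add_edge u v G)"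
  unfolding add_edge_def by (auto intro!: pair_graph_union pair_graph_edge_graph)

lemmas pair_graph_intros =
  pair_graph_map_graph pair_graph_union pair_graph_edge_graph pair_graph_add_edge

lemmas graph_defs = map_graph_def graph_union_def edge_graph_def add_edge_def

lemma pverts_simps [simp]:
  "pverts (map_graph f G) = f ` pverts G"
  "pverts (graph_union G H) = pverts G \<union> pverts H"
  "pverts (edge_graph E) = fst ` E \<union> snd ` E"
  "pverts (add_edge u v G) = insert u (insert v (pverts G))"
  by (auto simp: graph_defs)

lemma inj_join_map: "inj_on (join_map i H) X"
  by (auto simp: inj_on_def join_map_def)

lemma rooted_K1: "rooted K1"
  by (auto simp: rooted_def K1_def pair_graph_iff sym_def)

lemma rooted_pendant: "rooted H \<Longrightarrow> rooted (H\<^sup>\<up>)"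
  unfolding rooted_def pendant_def
  by (auto intro!: pair_graph_intros simp: inj_on_def)

lemma rooted_join:
  assumes "rooted H" and "rooted K"
  shows "rooted (H \<odot> K)"
proof -
  have "join_map 1 H (root_of H) \<in> join_map 1 H ` pverts (graph_of H)"
    using assms(1) by (simp add: rooted_def)
  then have "Atom 0 \<in> pverts (graph_of (H \<odot> K))"
    by (simp add: rooted_join_def join_map_def)
  moreover have "pair_graph (graph_of (H \<odot> K))"
    using assms by (auto simp: rooted_def rooted_join_def intro!: pair_graph_intros inj_join_map)
  ultimately show ?thesis
    by (simp add: rooted_def rooted_join_def)
qed

lemma rooted_compose:
  assumes "is_connector K" "rooted H1" "rooted H2"
  shows "rooted (compose K H1 H2)"
  using assms unfolding is_connector_def rooted_def compose_def
  by (auto intro!: pair_graph_intros simp: inj_on_def)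

lemma rooted_seed_B: "rooted seed_B"
proof -
  have "pair_graph (graph_of seed_B)"
    by (auto simp: seed_B_def intro!: pair_graph_intros inj_onI)
  then show ?thesis
    by (simp add: rooted_def seed_B_def)
qed

lemma is_connector_A: "is_connector connector_A"
proof -
  let ?G = "graph_of connector_A"
  have pg: "pair_graph ?G"
    by (auto simp: connector_A_def intro!: pair_graph_intros inj_onI)
  then interpret pair_graph ?G .
  have V: "pverts ?G = Atom ` {1, 2, 3, 4, 5, 6}"
    by (auto simp: connector_A_def)
  have arcs: "(Atom 1, Atom 2) \<in> parcs ?G" "(Atom 2, Atom 3) \<in> parcs ?G"
    "(Atom 3, Atom 4) \<in> parcs ?G" "(Atom 4, Atom 5) \<in> parcs ?G" "(Atom 3, Atom 6) \<in> parcs ?G"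
    by (auto simp: connector_A_def graph_defs)
  note adj = arcs[THEN reachable_adjI]
  have from1: "Atom 1 \<rightarrow>\<^sup>*\<^bsub>with_proj ?G\<^esub> v" if "v \<in> pverts ?G" for v
  proof -
    have 2: "Atom 1 \<rightarrow>\<^sup>*\<^bsub>with_proj ?G\<^esub> Atom 2" using adj by blast
    have 3: "Atom 1 \<rightarrow>\<^sup>*\<^bsub>with_proj ?G\<^esub> Atom 3" using 2 adj by (blast intro: reachable_trans)
    have 4: "Atom 1 \<rightarrow>\<^sup>*\<^bsub>with_proj ?G\<^esub> Atom 4" using 3 adj by (blast intro: reachable_trans)
    have 5: "Atom 1 \<rightarrow>\<^sup>*\<^bsub>with_proj ?G\<^esub> Atom 5" using 4 adj by (blast intro: reachable_trans)
    have 6: "Atom 1 \<rightarrow>\<^sup>*\<^bsub>with_proj ?G\<^esub> Atom 6" using 3 adj by (blast intro: reachable_trans)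
    have 1: "Atom 1 \<rightarrow>\<^sup>*\<^bsub>with_proj ?G\<^esub> Atom 1" using V by (simp add: reachable_refl)
    show ?thesis using that 1 2 3 4 5 6 unfolding V by auto
  qed
  have "strongly_connected (with_proj ?G)"
    unfolding strongly_connected_def
  proof (intro conjI ballI)
    show "verts (with_proj ?G) \<noteq> {}" by (simp add: V)
    fix u v assume "u \<in> verts (with_proj ?G)" "v \<in> verts (with_proj ?G)"
    then have "Atom 1 \<rightarrow>\<^sup>*\<^bsub>with_proj ?G\<^esub> u" "Atom 1 \<rightarrow>\<^sup>*\<^bsub>with_proj ?G\<^esub> v"
      using from1 by simp_all
    then show "u \<rightarrow>\<^sup>*\<^bsub>with_proj ?G\<^esub> v"
      using symmetric_reachable[OF sym_arcs] reachable_trans by blast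
  qed
  then have "Digraph_Component.connected (with_proj ?G)"
    unfolding Digraph_Component.connected_def strongly_connected_def
    by (auto intro: reachable_mk_symmetricI)
  with pg V show ?thesis
    by (auto simp: is_connector_def rooted_def connector_A_def)
qed

lemma rooted_Bstar: "rooted (Bstar t)"
proof (induction t)
  case 0
  then show ?case
    by (simp add: bowtie_def ltimes_def rooted_join rooted_pendant rooted_K1 rooted_seed_B)
next
  case (Suc t)
  then show ?case
    by (simp add: rooted_compose is_connector_A)
qed

lemma pair_graph_Bhat: "pair_graph (Bhat t)"
  using rooted_Bstar[of t] unfolding rooted_def Bhat_def closure_graph_def
  by (auto intro!: pair_graph_intros simp: inj_on_def)

end

theory Submission
  imports Defs "HOL-Real_Asymp.Real_Asymp"
begin

text \<open>
  Domination and packing are dual conditions on closed neighbourhoods: a dominating set meets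
  every closed neighbourhood at least once, and a set of vertices pairwise at distance at least 3
  is a set that meets every closed neighbourhood at most once (\<open>packing_set_iff_packs\<close>). All
  operations of the construction glue graphs along a root or along one edge at a root, so what the
  rest of the graph sees of a piece is captured by three optimal values for domination and three
  for packing, according to what happens at the root. These are the profiles below. They are
  transformed by a pendant edge and by a rooted join through explicit formulas, and starting from
  the seed \<open>B\<close> one computes that \<open>B\<^sub>0\<close> has the constant profiles \<open>(11, 11, 11)\<close> and
  \<open>(5, 5, 5)\<close>.

  Constant profiles mean that the root is inert: excusing it from being dominated saves nothing,
  and keeping its whole closed neighbourhood out of a packing costs nothing. Hence attaching such a
  piece by one edge at its root merely adds its two numbers to those of the other side, as long as
  the vertex at the other end of the edge is excused from being dominated as well
  (\<open>exempt_domination_bridge\<close>, \<open>pack_profile_bridge\<close>). The connector \<open>A\<close> still needs 2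
  vertices for its domination when its root and both ports are excused, and its packings have at
  most 1 vertex, attained at distance 2 from the root. So the recursion step turns the two numbers
  \<open>(m, p)\<close> into \<open>(2 * m + 2, 2 * p + 1)\<close> and preserves inertness of the root, and the closure
  doubles them. Since \<open>A\<close> adds 2 on one side and 1 on the other, it contributes nothing to
  \<open>m - 2 * p\<close>; this difference starts at \<open>11 - 2 * 5 = 1\<close> and doubles at every step, which is
  the source of the gap \<open>2 ^ (t + 1)\<close>.

  Order, degrees and connectedness are carried along the same construction
  (\<open>rooted_subcubic\<close>). The graphs are not cubic because the leaf created by the \<open>K\<^sub>1\<^sup>\<up>\<close> inside
  \<open>B\<^sub>0\<close> is never touched again.
\<close>

section \<open>Closed neighbourhoods\<close>

lemma closed_nbhd_self [simp]: "v \<in> closed_nbhd G v"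
  by (simp add: closed_nbhd_def)

lemma closed_nbhd_within: "pair_graph G \<Longrightarrow> v \<in> pverts G \<Longrightarrow> closed_nbhd G v \<subseteq> pverts G"
  by (auto simp: closed_nbhd_def pair_graph_iff)

lemma closed_nbhd_outside: "pair_graph G \<Longrightarrow> v \<notin> pverts G \<Longrightarrow> closed_nbhd G v = {v}"
  by (auto simp: closed_nbhd_def pair_graph_iff)

lemma closed_nbhd_sym: "pair_graph G \<Longrightarrow> u \<in> closed_nbhd G v \<longleftrightarrow> v \<in> closed_nbhd G u"
  by (auto simp: closed_nbhd_def pair_graph_iff sym_def)

lemma finite_pverts: "pair_graph G \<Longrightarrow> finite (pverts G)"
  by (simp add: pair_graph_iff)

lemma finite_closed_nbhd: "pair_graph G \<Longrightarrow> finite (closed_nbhd G v)"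
  by (metis closed_nbhd_outside closed_nbhd_within finite.emptyI finite.insertI finite_pverts
      finite_subset)

lemma closed_nbhd_graph_union:
  "closed_nbhd (graph_union G H) v = closed_nbhd G v \<union> closed_nbhd H v"
  by (auto simp: closed_nbhd_def graph_union_def)

lemma closed_nbhd_add_edge:
  "closed_nbhd (add_edge u w G) v =
     closed_nbhd G v \<union> (if v = u then {w} else {}) \<union> (if v = w then {u} else {})"
  by (auto simp: closed_nbhd_def graph_defs)

lemma closed_nbhd_map_graph:
  "inj f \<Longrightarrow> closed_nbhd (map_graph f G) (f v) = f ` closed_nbhd G v"
  by (auto simp: closed_nbhd_def map_graph_def inj_eq)

text \<open>
  The set \<open>W\<close> of vertices to be dominated is kept as a parameter, because a piece of a larger
  graph may have its root dominated from outside.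
\<close>

definition covers :: "'a pair_pre_digraph \<Rightarrow> 'a set \<Rightarrow> 'a set \<Rightarrow> bool" where
  "covers G D W \<longleftrightarrow> D \<subseteq> pverts G \<and> (\<forall>v\<in>W. D \<inter> closed_nbhd G v \<noteq> {})"

lemma dominating_set_iff_covers: "dominating_set G D \<longleftrightarrow> covers G D (pverts G)"
  by (simp add: dominating_set_def covers_def)

definition packs :: "'a pair_pre_digraph \<Rightarrow> 'a set \<Rightarrow> bool" where
  "packs G P \<longleftrightarrow> P \<subseteq> pverts G \<and>
     (\<forall>w \<in> pverts G. \<forall>u \<in> P \<inter> closed_nbhd G w. \<forall>v \<in> P \<inter> closed_nbhd G w. u = v)"

lemma packsI:
  assumes "P \<subseteq> pverts G"
    and "\<And>w u v. \<lbrakk>w \<in> pverts G; u \<in> P; v \<in> P; u \<in> closed_nbhd G w; v \<in> closed_nbhd G w\<rbrakk> \<Longrightarrow> u = v"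
  shows "packs G P"
  unfolding packs_def using assms(1) by (auto intro: assms(2))

lemma packsD:
  "\<lbrakk>packs G P; w \<in> pverts G; u \<in> P; v \<in> P; u \<in> closed_nbhd G w; v \<in> closed_nbhd G w\<rbrakk> \<Longrightarrow> u = v"
  unfolding packs_def by simp

lemma packs_within: "packs G P \<Longrightarrow> P \<subseteq> pverts G"
  by (simp add: packs_def)

lemma packs_subset: "packs G P \<Longrightarrow> Q \<subseteq> P \<Longrightarrow> packs G Q"
  by (rule packsI) (auto dest: packs_within packsD)

lemma packs_singleton: "v \<in> pverts G \<Longrightarrow> packs G {v}"
  by (rule packsI) auto

text \<open>
  A walk of length at most 2 between distinct vertices is an edge or a path through a common
  neighbour, which is the same as a common element of the closed neighbourhoods.
\<close>

lemma graph_dist_ge_3_iff: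
  assumes "pair_graph G" "u \<in> pverts G" "v \<in> pverts G" "u \<noteq> v"
  shows "graph_dist G u v \<ge> 3 \<longleftrightarrow> closed_nbhd G u \<inter> closed_nbhd G v = {}"
proof -
  interpret pair_graph G by fact
  have "closed_nbhd G u \<inter> closed_nbhd G v = {} \<longleftrightarrow> (\<forall>p. awalk u p v \<longrightarrow> 3 \<le> length p)"
  proof
    assume disj: "closed_nbhd G u \<inter> closed_nbhd G v = {}"
    show "\<forall>p. awalk u p v \<longrightarrow> 3 \<le> length p"
    proof (intro allI impI, rule ccontr)
      fix p assume p: "awalk u p v" "\<not> 3 \<le> length p"
      then consider "p = []" | e where "p = [e]" | e f where "p = [e, f]"
        by (cases p; cases "tl p"; cases "tl (tl p)") auto
      then show False
      proof cases
        case 1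
        then show False using p assms(4) by (simp add: awalk_def)
      next
        case 2
        then have "(u, v) \<in> parcs G"
          using p by (cases e) (auto simp: awalk_def)
        then show False using disj by (auto simp: closed_nbhd_def)
      next
        case 3
        then obtain w where "(u, w) \<in> parcs G" "(w, v) \<in> parcs G"
          using p by (cases e; cases f) (auto simp: awalk_def)
        then show False using disj arcs_symmetric by (auto simp: closed_nbhd_def)
      qed
    qed
  next
    assume far: "\<forall>p. awalk u p v \<longrightarrow> 3 \<le> length p"
    show "closed_nbhd G u \<inter> closed_nbhd G v = {}"
    proof (rule ccontr)
      assume "closed_nbhd G u \<inter> closed_nbhd G v \<noteq> {}"
      then obtain w where w: "w = u \<or> (u, w) \<in> parcs G" "w = v \<or> (w, v) \<in> parcs G"
        using arcs_symmetric by (auto simp: closed_nbhd_def)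
      then consider "(u, v) \<in> parcs G" | "(u, w) \<in> parcs G" "(w, v) \<in> parcs G"
        using assms(4) by auto
      then show False
      proof cases
        case 1
        then have "awalk u [(u, v)] v" using assms by (simp add: awalk_def)
        then have "3 \<le> length [(u, v)]" using far by blast
        then show False by simp
      next
        case 2
        then have "awalk u [(u, w), (w, v)] v" using assms by (simp add: awalk_def)
        then have "3 \<le> length [(u, w), (w, v)]" using far by blast
        then show False by simp
      qed
    qed
  qed
  also have "\<dots> \<longleftrightarrow> graph_dist G u v \<ge> 3"
    unfolding graph_dist_eq_INF_length[OF assms(1)] by (simp add: le_INF_iff)
  finally show ?thesis by blast
qed

lemma packing_set_iff_packs:
  assumes "pair_graph G"
  shows "packing_set G P \<longleftrightarrow> packs G P"
proof (cases "P \<subseteq> pverts G")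
  case True
  have "packing_set G P \<longleftrightarrow>
      (\<forall>u\<in>P. \<forall>v\<in>P. u \<noteq> v \<longrightarrow> closed_nbhd G u \<inter> closed_nbhd G v = {})"
    using True graph_dist_ge_3_iff[OF assms] by (auto simp: packing_set_def subset_iff)
  also have "\<dots> \<longleftrightarrow> packs G P"
  proof
    assume disj: "\<forall>u\<in>P. \<forall>v\<in>P. u \<noteq> v \<longrightarrow> closed_nbhd G u \<inter> closed_nbhd G v = {}"
    show "packs G P"
    proof (rule packsI[OF True])
      fix w u v
      assume "u \<in> P" "v \<in> P" "u \<in> closed_nbhd G w" "v \<in> closed_nbhd G w"
      then have "u \<in> P" "v \<in> P" "w \<in> closed_nbhd G u" "w \<in> closed_nbhd G v"
        using closed_nbhd_sym[OF assms, of w] by auto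
      then show "u = v" using disj by blast
    qed
  next
    assume packs: "packs G P"
    show "\<forall>u\<in>P. \<forall>v\<in>P. u \<noteq> v \<longrightarrow> closed_nbhd G u \<inter> closed_nbhd G v = {}"
    proof (intro ballI impI, rule ccontr)
      fix u v assume uv: "u \<in> P" "v \<in> P" "u \<noteq> v" "closed_nbhd G u \<inter> closed_nbhd G v \<noteq> {}"
      then obtain w where w: "w \<in> closed_nbhd G u" "w \<in> closed_nbhd G v" by blast
      then have "w \<in> pverts G" using closed_nbhd_within[OF assms] True uv(1) by blast
      moreover have "u \<in> closed_nbhd G w" "v \<in> closed_nbhd G w"
        using w closed_nbhd_sym[OF assms, of w] by auto
      ultimately show False using packsD[OF packs] uv(1-3) by blast
    qed
  qed
  finally show ?thesis .
qed (simp add: packing_set_def packs_def)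

lemma graph_union_commute: "graph_union G H = graph_union H G"
  by (simp add: graph_union_def Un_commute)

lemma covers_graph_union:
  "covers G D W \<Longrightarrow> covers G' D' W' \<Longrightarrow> covers (graph_union G G') (D \<union> D') (W \<union> W')"
  by (fastforce simp: covers_def closed_nbhd_graph_union)

lemma covers_add_edge: "covers G D W \<Longrightarrow> covers (add_edge u v G) D W"
  by (fastforce simp: covers_def closed_nbhd_add_edge)

lemma packs_graph_union_left: "packs (graph_union G H) P \<Longrightarrow> packs G (P \<inter> pverts G)"
  by (rule packsI) (auto dest: packsD simp: closed_nbhd_graph_union)

lemma packs_add_edge:
  assumes "packs (add_edge u v G) P" "u \<in> pverts G" "v \<in> pverts G"
  shows "packs G P"
proof (rule packsI)
  show "P \<subseteq> pverts G" using packs_within[OF assms(1)] assms(2,3) by auto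
  fix w s t
  assume "w \<in> pverts G" "s \<in> P" "t \<in> P" "s \<in> closed_nbhd G w" "t \<in> closed_nbhd G w"
  then show "s = t" using packsD[OF assms(1), of w s t] by (simp add: closed_nbhd_add_edge)
qed


section \<open>Profiles of rooted graphs\<close>

text \<open>
  The optimal sizes of a set dominating everything except possibly the root (\<open>c\<close>),
  dominating everything (\<open>b\<close>), and dominating everything and containing the root (\<open>a\<close>). The lower
  bounds are all stated for sets that dominate the non-root vertices, which is what the
  restriction of a dominating set of a larger graph to this piece satisfies.
\<close>

definition dom_profile :: "'a pair_pre_digraph \<Rightarrow> 'a \<Rightarrow> nat \<Rightarrow> nat \<Rightarrow> nat \<Rightarrow> bool" where
  "dom_profile G r c b a \<longleftrightarrow>
     (\<forall>D. covers G D (pverts G - {r}) \<longrightarrow>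
        c \<le> card D \<and> (D \<inter> closed_nbhd G r \<noteq> {} \<longrightarrow> b \<le> card D) \<and> (r \<in> D \<longrightarrow> a \<le> card D)) \<and>
     (\<exists>D. covers G D (pverts G - {r}) \<and> card D \<le> c) \<and>
     (\<exists>D. covers G D (pverts G) \<and> card D \<le> b) \<and>
     (\<exists>D. covers G D (pverts G) \<and> r \<in> D \<and> card D \<le> a)"

text \<open>
  The dual values: the largest packing that avoids the closed neighbourhood of the root (\<open>z\<close>),
  that avoids the root (\<open>y\<close>), and without restriction (\<open>x\<close>).
\<close>

definition pack_profile :: "'a pair_pre_digraph \<Rightarrow> 'a \<Rightarrow> nat \<Rightarrow> nat \<Rightarrow> nat \<Rightarrow> bool" where
  "pack_profile G r z y x \<longleftrightarrow>
     (\<forall>P. packs G P \<longrightarrow>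
        card P \<le> x \<and> (r \<notin> P \<longrightarrow> card P \<le> y) \<and> (P \<inter> closed_nbhd G r = {} \<longrightarrow> card P \<le> z)) \<and>
     (\<exists>P. packs G P \<and> P \<inter> closed_nbhd G r = {} \<and> z \<le> card P) \<and>
     (\<exists>P. packs G P \<and> r \<notin> P \<and> y \<le> card P) \<and>
     (\<exists>P. packs G P \<and> x \<le> card P)"

text \<open>
  The root itself can always be added to a set, which repairs its missing domination at the price
  of one vertex.
\<close>

lemma dom_profile_bounds:
  assumes "dom_profile G r c b a" "r \<in> pverts G"
  shows "c \<le> b" "b \<le> a" "a \<le> c + 1"
proof -
  have lower: "c \<le> card D" "D \<inter> closed_nbhd G r \<noteq> {} \<Longrightarrow> b \<le> card D" "r \<in> D \<Longrightarrow> a \<le> card D"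
    if "covers G D (pverts G - {r})" for D
    using that assms(1) unfolding dom_profile_def by blast+
  have weaken: "covers G D (pverts G - {r})" "D \<inter> closed_nbhd G r \<noteq> {}"
    if "covers G D (pverts G)" for D
    using that assms(2) unfolding covers_def by auto
  obtain Dc where Dc: "covers G Dc (pverts G - {r})" "card Dc \<le> c"
    using assms(1) unfolding dom_profile_def by blast
  obtain Db where Db: "covers G Db (pverts G)" "card Db \<le> b"
    using assms(1) unfolding dom_profile_def by blast
  obtain Da where Da: "covers G Da (pverts G)" "card Da \<le> a"
    using assms(1) unfolding dom_profile_def by blast
  show "c \<le> b" using lower(1)[OF weaken(1)[OF Db(1)]] Db(2) by linarith
  show "b \<le> a" using lower(2)[OF weaken[OF Da(1)]] Da(2) by linarith
  have "covers G (insert r Dc) (pverts G - {r})"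
    using Dc(1) assms(2) unfolding covers_def by auto
  then have "a \<le> card (insert r Dc)" using lower(3) by blast
  also have "\<dots> \<le> c + 1"
    using card_insert_le_m1[of "c + 1" Dc r] Dc(2) by simp
  finally show "a \<le> c + 1" .
qed

text \<open>
  A packing has at most one vertex in the closed neighbourhood of the root, so removing that vertex
  reaches the most restricted case.
\<close>

lemma pack_profile_bounds:
  assumes "pack_profile G r z y x" "r \<in> pverts G"
  shows "z \<le> y" "y \<le> x" "x \<le> z + 1"
proof -
  have upper: "card P \<le> x" "r \<notin> P \<Longrightarrow> card P \<le> y" "P \<inter> closed_nbhd G r = {} \<Longrightarrow> card P \<le> z"
    if "packs G P" for P
    using that assms(1) unfolding pack_profile_def by blast+
  obtain Pz where Pz: "packs G Pz" "Pz \<inter> closed_nbhd G r = {}" "z \<le> card Pz"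
    using assms(1) unfolding pack_profile_def by blast
  obtain Py where Py: "packs G Py" "y \<le> card Py"
    using assms(1) unfolding pack_profile_def by blast
  obtain Px where Px: "packs G Px" "x \<le> card Px"
    using assms(1) unfolding pack_profile_def by blast
  have "r \<notin> Pz" using Pz(2) closed_nbhd_self[of r G] by blast
  then show "z \<le> y" using upper(2)[OF Pz(1)] Pz(3) by linarith
  show "y \<le> x" using upper(1)[OF Py(1)] Py(2) by linarith
  obtain u where u: "Px \<inter> closed_nbhd G r \<subseteq> {u}"
    using packsD[OF Px(1) assms(2)] by (cases "Px \<inter> closed_nbhd G r = {}") blast+
  have "card (Px - {u}) \<le> z"
    using upper(3)[of "Px - {u}"] packs_subset[OF Px(1), of "Px - {u}"] u by blast
  moreover have "card Px \<le> card (Px - {u}) + 1"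
    using diff_card_le_card_Diff[of "{u}" Px] by simp
  ultimately show "x \<le> z + 1" using Px(2) by linarith
qed

lemma covers_map_graph:
  "inj f \<Longrightarrow> covers (map_graph f G) (f ` D) (f ` W) \<longleftrightarrow> covers G D W"
  by (simp add: covers_def closed_nbhd_map_graph inj_image_subset_iff flip: image_Int)

lemma packs_map_graph: "inj f \<Longrightarrow> packs (map_graph f G) (f ` P) \<longleftrightarrow> packs G P"
  by (simp add: packs_def closed_nbhd_map_graph inj_image_subset_iff inj_eq flip: image_Int)

lemma covers_image: "covers (map_graph f G) D W \<Longrightarrow> \<exists>D0. D = f ` D0"
  by (auto simp: covers_def subset_image_iff)

lemma packs_image: "packs (map_graph f G) P \<Longrightarrow> \<exists>P0. P = f ` P0"
  by (auto simp: packs_def subset_image_iff)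

lemma card_image_inj: "inj f \<Longrightarrow> card (f ` A) = card A"
  by (simp add: card_image inj_on_subset)

lemma dom_profile_map_graph:
  assumes "inj f" "dom_profile G r c b a"
  shows "dom_profile (map_graph f G) (f r) c b a"
proof -
  have V: "pverts (map_graph f G) - {f r} = f ` (pverts G - {r})"
    using assms(1) by (simp add: image_set_diff)
  have ex: "(\<exists>D. covers (map_graph f G) D (f ` W) \<and> Q D)
      \<longleftrightarrow> (\<exists>D. covers G D W \<and> Q (f ` D))" for W Q
    using covers_image covers_map_graph[OF assms(1)] by metis
  have all: "(\<forall>D. covers (map_graph f G) D (f ` W) \<longrightarrow> Q D)
      \<longleftrightarrow> (\<forall>D. covers G D W \<longrightarrow> Q (f ` D))" for W Q
    using covers_image covers_map_graph[OF assms(1)] by metis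
  show ?thesis
    using assms unfolding dom_profile_def V unfolding pverts_simps ex all
    by (simp add: card_image_inj closed_nbhd_map_graph inj_image_mem_iff flip: image_Int)
qed

lemma pack_profile_map_graph:
  assumes "inj f" "pack_profile G r z y x"
  shows "pack_profile (map_graph f G) (f r) z y x"
proof -
  have ex: "(\<exists>P. packs (map_graph f G) P \<and> Q P) \<longleftrightarrow> (\<exists>P. packs G P \<and> Q (f ` P))" for Q
    using packs_image packs_map_graph[OF assms(1)] by metis
  have all: "(\<forall>P. packs (map_graph f G) P \<longrightarrow> Q P) \<longleftrightarrow> (\<forall>P. packs G P \<longrightarrow> Q (f ` P))" for Q
    using packs_image packs_map_graph[OF assms(1)] by metis
  show ?thesis
    using assms unfolding pack_profile_def ex all
    by (simp add: card_image_inj closed_nbhd_map_graph inj_image_mem_iff flip: image_Int)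
qed

text \<open>
  The three states of the new root \<open>p\<close> translate into states of the old root \<open>r\<close>. If \<open>p\<close> is in the
  set, then \<open>r\<close> is dominated for free, which costs \<open>c + 1\<close>. Otherwise only \<open>r\<close> can dominate
  \<open>p\<close>, which requires \<open>r\<close> in the set and costs \<open>a\<close>; if \<open>p\<close> need not be dominated, then the old part
  has to dominate itself, which costs \<open>b\<close>.
\<close>

lemma dom_profile_pendant:
  assumes G: "pair_graph G" "r \<in> pverts G" and p: "p \<notin> pverts G"
    and prof: "dom_profile G r c b a"
  shows "dom_profile (add_edge p r G) p b a (c + 1)"
proof -
  let ?G = "add_edge p r G"
  have "p \<noteq> r" using G p by blast
  have N: "closed_nbhd ?G p = {p, r}" "closed_nbhd ?G r = insert p (closed_nbhd G r)"
    "\<And>v. v \<in> pverts G \<Longrightarrow> v \<noteq> r \<Longrightarrow> closed_nbhd ?G v = closed_nbhd G v"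
    using closed_nbhd_outside[OF G(1) p] \<open>p \<noteq> r\<close> p
    by (auto simp: closed_nbhd_add_edge)
  note bounds = dom_profile_bounds[OF prof G(2)]
  have lower: "c \<le> card D" "D \<inter> closed_nbhd G r \<noteq> {} \<Longrightarrow> b \<le> card D" "r \<in> D \<Longrightarrow> a \<le> card D"
    if "covers G D (pverts G - {r})" for D
    using that prof unfolding dom_profile_def by blast+
  have lift: "covers ?G D (pverts G)" if "covers G D (pverts G)" for D
    using that G(2) by (auto simp: covers_def closed_nbhd_add_edge)
  have pV: "pverts ?G - {p} = pverts G" using G p by auto
  show ?thesis
    unfolding dom_profile_def pV
  proof (intro conjI allI impI)
    fix D assume D: "covers ?G D (pverts G)"
    have fin: "finite D"
      using D finite_pverts[OF G(1)] by (auto simp: covers_def intro: finite_subset)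
    have sub: "covers G (D - {p}) (pverts G - {r})"
      unfolding covers_def
    proof (intro conjI ballI)
      show "D - {p} \<subseteq> pverts G" using D G(2) by (auto simp: covers_def)
      fix v assume v: "v \<in> pverts G - {r}"
      then have "D \<inter> closed_nbhd ?G v \<noteq> {}" using D by (simp add: covers_def)
      then have "D \<inter> closed_nbhd G v \<noteq> {}" using N(3)[of v] v by simp
      moreover have "p \<notin> closed_nbhd G v" using closed_nbhd_within[OF G(1), of v] v p by blast
      ultimately show "(D - {p}) \<inter> closed_nbhd G v \<noteq> {}" by blast
    qed
    have with_p: "c + 1 \<le> card D" if "p \<in> D"
      using lower(1)[OF sub] that fin card_Suc_Diff1[of D p] by simp
    show "c + 1 \<le> card D" if "p \<in> D" using with_p that .
    have without_p: "b \<le> card D" "r \<in> D \<Longrightarrow> a \<le> card D" if "p \<notin> D"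
    proof -
      have "D \<inter> closed_nbhd ?G r \<noteq> {}" using D G(2) by (simp add: covers_def)
      then have "(D - {p}) \<inter> closed_nbhd G r \<noteq> {}" using that N(2) by auto
      then show "b \<le> card D" using lower(2)[OF sub] that by simp
      show "a \<le> card D" if "r \<in> D" using lower(3)[OF sub] that \<open>p \<notin> D\<close> by simp
    qed
    show "b \<le> card D" using with_p without_p(1) bounds by (cases "p \<in> D") auto
    show "a \<le> card D" if "D \<inter> closed_nbhd ?G p \<noteq> {}"
      using with_p without_p(2) bounds that N(1) by (cases "p \<in> D") auto
  next
    show "\<exists>D. covers ?G D (pverts G) \<and> card D \<le> b"
      using prof lift unfolding dom_profile_def by blast
  next
    obtain D where D: "covers G D (pverts G)" "r \<in> D" "card D \<le> a"
      using prof unfolding dom_profile_def by blast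
    then have "covers ?G D (pverts ?G)"
      using lift[OF D(1)] N(1) G(2) by (auto simp: covers_def)
    with D show "\<exists>D. covers ?G D (pverts ?G) \<and> card D \<le> a" by blast
  next
    obtain D where D: "covers G D (pverts G - {r})" "card D \<le> c"
      using prof unfolding dom_profile_def by blast
    have "insert p D \<inter> closed_nbhd ?G v \<noteq> {}" if "v \<in> pverts ?G" for v
      using D(1) that N by (cases "v = r"; cases "v = p") (auto simp: covers_def)
    then have "covers ?G (insert p D) (pverts ?G)"
      using D(1) by (auto simp: covers_def)
    moreover have "card (insert p D) \<le> c + 1"
      using card_insert_le_m1[of "c + 1" D p] D(2) by simp
    ultimately show "\<exists>D. covers ?G D (pverts ?G) \<and> p \<in> D \<and> card D \<le> c + 1" by blast
  qed
qed

text \<open>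
  The same rotation as for domination: a packing that contains \<open>p\<close> avoids the closed neighbourhood
  of \<open>r\<close>, one that avoids \<open>p\<close> is any packing of the old part, and one that avoids \<open>p\<close> and its only
  neighbour \<open>r\<close> is a packing that avoids \<open>r\<close>.
\<close>

lemma pack_profile_pendant:
  assumes G: "pair_graph G" "r \<in> pverts G" and p: "p \<notin> pverts G"
    and prof: "pack_profile G r z y x"
  shows "pack_profile (add_edge p r G) p y x (z + 1)"
proof -
  let ?G = "add_edge p r G"
  have "p \<noteq> r" using G p by blast
  have N: "closed_nbhd ?G p = {p, r}" "closed_nbhd ?G r = insert p (closed_nbhd G r)"
    "\<And>v. v \<in> pverts G \<Longrightarrow> v \<noteq> r \<Longrightarrow> closed_nbhd ?G v = closed_nbhd G v"
    using closed_nbhd_outside[OF G(1) p] \<open>p \<noteq> r\<close> p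
    by (auto simp: closed_nbhd_add_edge)
  note bounds = pack_profile_bounds[OF prof G(2)]
  have upper: "card P \<le> x" "r \<notin> P \<Longrightarrow> card P \<le> y" "P \<inter> closed_nbhd G r = {} \<Longrightarrow> card P \<le> z"
    if "packs G P" for P
    using that prof unfolding pack_profile_def by blast+
  have V: "pverts ?G = insert p (pverts G)" using G by auto
  have sub: "packs G (P - {p})" if P: "packs ?G P" for P
  proof (rule packsI)
    show "P - {p} \<subseteq> pverts G" using P V by (auto simp: packs_def)
    fix w u v
    assume "w \<in> pverts G" "u \<in> P - {p}" "v \<in> P - {p}" "u \<in> closed_nbhd G w" "v \<in> closed_nbhd G w"
    then show "u = v" using packsD[OF P, of w u v] by (simp add: closed_nbhd_add_edge)
  qed
  have lift: "packs ?G P" if P: "packs G P" for P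
  proof (rule packsI)
    show "P \<subseteq> pverts ?G" using P by (auto simp: packs_def)
    have "p \<notin> P" using P p by (auto simp: packs_def)
    fix w u v
    assume *: "w \<in> pverts ?G" "u \<in> P" "v \<in> P" "u \<in> closed_nbhd ?G w" "v \<in> closed_nbhd ?G w"
    show "u = v"
    proof (cases "w = p")
      case True
      then show ?thesis using * N(1) \<open>p \<notin> P\<close> by auto
    next
      case False
      then have "w \<in> pverts G" using *(1) G(2) by auto
      moreover have "u \<in> closed_nbhd G w" "v \<in> closed_nbhd G w"
        using * False \<open>p \<notin> P\<close> by (auto simp: closed_nbhd_add_edge split: if_splits)
      ultimately show ?thesis using packsD[OF P] * by blast
    qed
  qed
  show ?thesis
    unfolding pack_profile_def
  proof (intro conjI allI impI)
    fix P assume P: "packs ?G P"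
    have fin: "finite P"
      using P finite_pverts[OF G(1)] V by (auto simp: packs_def intro: finite_subset)
    have "card P \<le> z + 1" if "p \<in> P"
    proof -
      have "r \<in> pverts ?G" using V G by simp
      then have "u = p" if "u \<in> P" "u \<in> closed_nbhd G r" for u
        using packsD[OF P, of r u p] \<open>p \<in> P\<close> that N(2) by simp
      then have "(P - {p}) \<inter> closed_nbhd G r = {}" by auto
      then show ?thesis
        using upper(3)[OF sub[OF P]] fin that card_Suc_Diff1[of P p] by simp
    qed
    moreover have without_p: "card P \<le> x" "r \<notin> P \<Longrightarrow> card P \<le> y" if "p \<notin> P"
      using upper(1,2)[OF sub[OF P]] that by simp_all
    ultimately show "card P \<le> z + 1" using bounds by (cases "p \<in> P") auto
    show "card P \<le> x" if "p \<notin> P" using without_p that by blast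
    show "card P \<le> y" if "P \<inter> closed_nbhd ?G p = {}" using without_p that N(1) by blast
  next
    obtain P where P: "packs G P" "r \<notin> P" "y \<le> card P"
      using prof unfolding pack_profile_def by blast
    moreover have "P \<inter> closed_nbhd ?G p = {}"
      using P p N(1) by (auto simp: packs_def)
    ultimately show "\<exists>P. packs ?G P \<and> P \<inter> closed_nbhd ?G p = {} \<and> y \<le> card P"
      using lift[OF P(1)] by auto
  next
    obtain P where P: "packs G P" "x \<le> card P"
      using prof unfolding pack_profile_def by blast
    moreover have "p \<notin> P" using P p by (auto simp: packs_def)
    ultimately show "\<exists>P. packs ?G P \<and> p \<notin> P \<and> x \<le> card P"
      using lift[OF P(1)] by auto
  next
    obtain P where P: "packs G P" "P \<inter> closed_nbhd G r = {}" "z \<le> card P"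
      using prof unfolding pack_profile_def by blast
    have "p \<notin> P" "finite P"
      using P p finite_pverts[OF G(1)] by (auto simp: packs_def intro: finite_subset)
    have "r \<notin> P" using P closed_nbhd_self[of r G] by blast
    have "packs ?G (insert p P)"
    proof (rule packsI)
      show "insert p P \<subseteq> pverts ?G" using P by (auto simp: packs_def)
      fix w u v
      assume *: "w \<in> pverts ?G" "u \<in> insert p P" "v \<in> insert p P"
        "u \<in> closed_nbhd ?G w" "v \<in> closed_nbhd ?G w"
      consider "w = p" | "w = r" | "w \<in> pverts G" "w \<noteq> r"
        using * V by auto
      then show "u = v"
      proof cases
        case 1
        then show ?thesis using * N(1) \<open>r \<notin> P\<close> by auto
      next
        case 2
        then show ?thesis using * N(2) P(2) by auto
      next
        case 3
        have "p \<notin> closed_nbhd G w" using closed_nbhd_within[OF G(1) 3(1)] p by blast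
        then have "u \<in> P" "v \<in> P" "u \<in> closed_nbhd G w" "v \<in> closed_nbhd G w"
          using * N(3)[OF 3] by auto
        then show ?thesis using packsD[OF P(1) 3(1)] by blast
      qed
    qed
    moreover have "z + 1 \<le> card (insert p P)" using P(3) \<open>p \<notin> P\<close> \<open>finite P\<close> by simp
    ultimately show "\<exists>P. packs ?G P \<and> z + 1 \<le> card P" by blast
  qed
qed

lemma closed_nbhd_join:
  assumes "pair_graph G" "pair_graph H" "pverts G \<inter> pverts H = {r}"
  shows "v \<in> pverts G \<Longrightarrow> v \<noteq> r \<Longrightarrow> closed_nbhd (graph_union G H) v = closed_nbhd G v"
    and "v \<in> pverts H \<Longrightarrow> v \<noteq> r \<Longrightarrow> closed_nbhd (graph_union G H) v = closed_nbhd H v"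
proof -
  show "closed_nbhd (graph_union G H) v = closed_nbhd G v" if "v \<in> pverts G" "v \<noteq> r"
  proof -
    have "v \<notin> pverts H" using that assms(3) by blast
    then show ?thesis using closed_nbhd_outside[OF assms(2)] by (simp add: closed_nbhd_graph_union insert_absorb)
  qed
  show "closed_nbhd (graph_union G H) v = closed_nbhd H v" if "v \<in> pverts H" "v \<noteq> r"
  proof -
    have "v \<notin> pverts G" using that assms(3) by blast
    then show ?thesis using closed_nbhd_outside[OF assms(1)] by (simp add: closed_nbhd_graph_union insert_absorb)
  qed
qed

text \<open>
  Both parts of a join contain the root, so a set that contains the root is counted once too often.
\<close>

lemma card_split_at:
  assumes "finite X" "X \<subseteq> V \<union> W" "V \<inter> W = {r}"
  shows "card (X \<inter> V) + card (X \<inter> W) = card X + (if r \<in> X then 1 else 0)"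
proof -
  have "card (X \<inter> V) + card (X \<inter> W) = card ((X \<inter> V) \<union> (X \<inter> W)) + card ((X \<inter> V) \<inter> (X \<inter> W))"
    using assms(1) by (intro card_Un_Int) auto
  also have "(X \<inter> V) \<union> (X \<inter> W) = X" using assms(2) by blast
  also have "(X \<inter> V) \<inter> (X \<inter> W) = (if r \<in> X then {r} else {})" using assms(3) by auto
  finally show ?thesis by simp
qed

text \<open>
  If the shared root belongs to the dominating set, it is counted in both parts; otherwise the parts
  are disjoint and it suffices that one of them dominates the root. The sets that
  realize these values may happen to contain the root in one part only; their union is then still
  small enough.
\<close>

lemma dom_profile_join:
  assumes G: "pair_graph G" and H: "pair_graph H" and V: "pverts G \<inter> pverts H = {r}"
    and profG: "dom_profile G r c1 b1 a1" and profH: "dom_profile H r c2 b2 a2"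
  shows "dom_profile (graph_union G H) r (min (c1 + c2) (a1 + a2 - 1))
           (min (a1 + a2 - 1) (min (b1 + c2) (c1 + b2))) (a1 + a2 - 1)"
proof -
  let ?U = "graph_union G H"
  note N = closed_nbhd_join[OF G H V]
  have r: "r \<in> pverts G" "r \<in> pverts H" using V by auto
  note fin = finite_pverts[OF G] finite_pverts[OF H]
  have lowerG: "c1 \<le> card D" "D \<inter> closed_nbhd G r \<noteq> {} \<Longrightarrow> b1 \<le> card D" "r \<in> D \<Longrightarrow> a1 \<le> card D"
    if "covers G D (pverts G - {r})" for D
    using that profG unfolding dom_profile_def by blast+
  have lowerH: "c2 \<le> card D" "D \<inter> closed_nbhd H r \<noteq> {} \<Longrightarrow> b2 \<le> card D" "r \<in> D \<Longrightarrow> a2 \<le> card D"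
    if "covers H D (pverts H - {r})" for D
    using that profH unfolding dom_profile_def by blast+
  have lower: "min (c1 + c2) (a1 + a2 - 1) \<le> card D \<and>
      (D \<inter> closed_nbhd ?U r \<noteq> {} \<longrightarrow> min (a1 + a2 - 1) (min (b1 + c2) (c1 + b2)) \<le> card D) \<and>
      (r \<in> D \<longrightarrow> a1 + a2 - 1 \<le> card D)"
    if D: "covers ?U D (pverts ?U - {r})" for D
  proof -
    have sub: "D \<subseteq> pverts G \<union> pverts H" using D by (simp add: covers_def)
    then have card: "card (D \<inter> pverts G) + card (D \<inter> pverts H) = card D + (if r \<in> D then 1 else 0)"
      using V fin by (intro card_split_at) (auto intro: finite_subset)
    have "D \<inter> pverts G \<inter> closed_nbhd G v \<noteq> {}" if v: "v \<in> pverts G - {r}" for v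
    proof -
      have "D \<inter> closed_nbhd ?U v \<noteq> {}" using D v by (simp add: covers_def)
      then show ?thesis using N(1)[of v] v closed_nbhd_within[OF G, of v] by auto
    qed
    then have DG: "covers G (D \<inter> pverts G) (pverts G - {r})" by (simp add: covers_def)
    have "D \<inter> pverts H \<inter> closed_nbhd H v \<noteq> {}" if v: "v \<in> pverts H - {r}" for v
    proof -
      have "D \<inter> closed_nbhd ?U v \<noteq> {}" using D v by (simp add: covers_def)
      then show ?thesis using N(2)[of v] v closed_nbhd_within[OF H, of v] by auto
    qed
    then have DH: "covers H (D \<inter> pverts H) (pverts H - {r})" by (simp add: covers_def)
    show ?thesis
    proof (cases "r \<in> D")
      case True
      then show ?thesis using lowerG(3)[OF DG] lowerH(3)[OF DH] r card by auto
    next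
      case False
      note le = lowerG(1)[OF DG] lowerH(1)[OF DH]
      have "b1 \<le> card (D \<inter> pverts G) \<or> b2 \<le> card (D \<inter> pverts H)"
        if hit: "D \<inter> closed_nbhd ?U r \<noteq> {}"
      proof -
        obtain d where "d \<in> D" "d \<in> closed_nbhd G r \<or> d \<in> closed_nbhd H r"
          using hit unfolding closed_nbhd_graph_union by blast
        then have "D \<inter> pverts G \<inter> closed_nbhd G r \<noteq> {} \<or> D \<inter> pverts H \<inter> closed_nbhd H r \<noteq> {}"
          using closed_nbhd_within[OF G r(1)] closed_nbhd_within[OF H r(2)] by blast
        then show ?thesis using lowerG(2)[OF DG] lowerH(2)[OF DH] by blast
      qed
      then have "b1 + c2 \<le> card D \<or> c1 + b2 \<le> card D" if "D \<inter> closed_nbhd ?U r \<noteq> {}"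
        using that le card False by fastforce
      moreover have "c1 + c2 \<le> card D" using le card False by simp
      ultimately show ?thesis using False unfolding min_le_iff_disj by blast
    qed
  qed
  obtain C1 B1 A1 where CBA1: "covers G C1 (pverts G - {r})" "card C1 \<le> c1"
    "covers G B1 (pverts G)" "card B1 \<le> b1" "covers G A1 (pverts G)" "r \<in> A1" "card A1 \<le> a1"
    using profG unfolding dom_profile_def by blast
  obtain C2 B2 A2 where CBA2: "covers H C2 (pverts H - {r})" "card C2 \<le> c2"
    "covers H B2 (pverts H)" "card B2 \<le> b2" "covers H A2 (pverts H)" "r \<in> A2" "card A2 \<le> a2"
    using profH unfolding dom_profile_def by blast
  have W: "(pverts G - {r}) \<union> (pverts H - {r}) = pverts ?U - {r}"
    "pverts G \<union> (pverts H - {r}) = pverts ?U" "(pverts G - {r}) \<union> pverts H = pverts ?U"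
    "pverts G \<union> pverts H = pverts ?U"
    using r by auto
  have AA: "covers ?U (A1 \<union> A2) (pverts ?U)" "card (A1 \<union> A2) \<le> a1 + a2 - 1"
  proof -
    show "covers ?U (A1 \<union> A2) (pverts ?U)"
      using covers_graph_union[OF CBA1(5) CBA2(5)] unfolding W .
    have finA: "finite A1" "finite A2"
      using CBA1(5) CBA2(5) fin by (auto simp: covers_def intro: finite_subset)
    then have "card (A1 \<union> A2) + card (A1 \<inter> A2) = card A1 + card A2"
      using card_Un_Int by metis
    moreover have "card (A1 \<inter> A2) \<noteq> 0" using finA CBA1(6) CBA2(6) by auto
    ultimately show "card (A1 \<union> A2) \<le> a1 + a2 - 1" using CBA1(7) CBA2(7) by linarith
  qed
  have BC: "covers ?U (B1 \<union> C2) (pverts ?U)" "card (B1 \<union> C2) \<le> b1 + c2"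
    using covers_graph_union[OF CBA1(3) CBA2(1)] card_Un_le[of B1 C2] CBA1(4) CBA2(2)
    unfolding W by simp_all
  have CB: "covers ?U (C1 \<union> B2) (pverts ?U)" "card (C1 \<union> B2) \<le> c1 + b2"
    using covers_graph_union[OF CBA1(1) CBA2(3)] card_Un_le[of C1 B2] CBA1(2) CBA2(4)
    unfolding W by simp_all
  have CC: "covers ?U (C1 \<union> C2) (pverts ?U - {r})" "card (C1 \<union> C2) \<le> c1 + c2"
    using covers_graph_union[OF CBA1(1) CBA2(1)] card_Un_le[of C1 C2] CBA1(2) CBA2(2)
    unfolding W by simp_all
  have weaken: "covers ?U D (pverts ?U - {r})" if "covers ?U D (pverts ?U)" for D
    using that by (simp add: covers_def)
  show ?thesis
    unfolding dom_profile_def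
  proof (intro conjI)
    show "\<exists>D. covers ?U D (pverts ?U - {r}) \<and> card D \<le> min (c1 + c2) (a1 + a2 - 1)"
      using CC AA(2) weaken[OF AA(1)] unfolding min_def by (cases "c1 + c2 \<le> a1 + a2 - 1") auto
    show "\<exists>D. covers ?U D (pverts ?U) \<and> card D \<le> min (a1 + a2 - 1) (min (b1 + c2) (c1 + b2))"
      using AA BC CB by (metis min_def)
    show "\<exists>D. covers ?U D (pverts ?U) \<and> r \<in> D \<and> card D \<le> a1 + a2 - 1"
      using AA CBA1(6) by blast
  qed (use lower in blast)
qed

text \<open>
  Away from the root the closed neighbourhoods of the union lie in one part. So two packings are
  compatible as soon as they agree about the root and together have at most one vertex in its
  closed neighbourhood.
\<close>

lemma packs_join:
  assumes G: "pair_graph G" and H: "pair_graph H" and V: "pverts G \<inter> pverts H = {r}"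
    and P: "packs G P" and Q: "packs H Q" and "r \<in> P \<longleftrightarrow> r \<in> Q"
    and root: "\<And>u v. u \<in> P \<inter> closed_nbhd G r \<Longrightarrow> v \<in> Q \<inter> closed_nbhd H r \<Longrightarrow> u = v"
  shows "packs (graph_union G H) (P \<union> Q)"
proof (rule packsI)
  let ?U = "graph_union G H"
  show "P \<union> Q \<subseteq> pverts ?U"
    using packs_within[OF P] packs_within[OF Q] by auto
  note N = closed_nbhd_join[OF G H V]
  have r: "r \<in> pverts G" "r \<in> pverts H" using V by auto
  fix w u v
  assume w: "w \<in> pverts ?U"
    and uv: "u \<in> P \<union> Q" "v \<in> P \<union> Q" "u \<in> closed_nbhd ?U w" "v \<in> closed_nbhd ?U w"
  consider "w = r" | "w \<in> pverts G" "w \<noteq> r" | "w \<in> pverts H" "w \<noteq> r"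
    using w by auto
  then show "u = v"
  proof cases
    case 1
    have side: "s \<in> P \<inter> closed_nbhd G r \<or> s \<in> Q \<inter> closed_nbhd H r"
      if s: "s \<in> P \<union> Q" "s \<in> closed_nbhd ?U w" for s
    proof (cases "s = r")
      case True
      then show ?thesis using s(1) by auto
    next
      case False
      have "s \<in> closed_nbhd G r \<or> s \<in> closed_nbhd H r"
        using s(2) 1 by (simp add: closed_nbhd_graph_union)
      then show ?thesis
        using s(1) False closed_nbhd_within[OF G r(1)] closed_nbhd_within[OF H r(2)] V
          packs_within[OF P] packs_within[OF Q] by blast
    qed
    show ?thesis
      using side[OF uv(1,3)] side[OF uv(2,4)] root packsD[OF P r(1), of u v] packsD[OF Q r(2), of u v]
      by auto
  next
    case 2
    then have Nw: "closed_nbhd ?U w = closed_nbhd G w" using N(1) by blast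
    have "s \<in> P" if "s \<in> P \<union> Q" "s \<in> closed_nbhd G w" for s
      using that closed_nbhd_within[OF G 2(1)] packs_within[OF Q] V \<open>r \<in> P \<longleftrightarrow> r \<in> Q\<close> by auto
    then show ?thesis using packsD[OF P 2(1), of u v] uv Nw by blast
  next
    case 3
    then have Nw: "closed_nbhd ?U w = closed_nbhd H w" using N(2) by blast
    have "s \<in> Q" if "s \<in> P \<union> Q" "s \<in> closed_nbhd H w" for s
      using that closed_nbhd_within[OF H 3(1)] packs_within[OF P] V \<open>r \<in> P \<longleftrightarrow> r \<in> Q\<close> by auto
    then show ?thesis using packsD[OF Q 3(1), of u v] uv Nw by blast
  qed
qed

text \<open>
  A packing without the root has a vertex in the closed neighbourhood of the root on at most one
  side; a packing with the root is counted twice at the root. The bound \<open>x1 + x2 - 1\<close> is attained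
  even if an optimal packing of one side avoids the root: then \<open>x1 \<le> y1\<close>, say, and
  \<open>x2 \<le> z2 + 1\<close>, so that a packing of size \<open>y1 + z2\<close> without the root is large enough.
\<close>

lemma pack_profile_join:
  assumes G: "pair_graph G" and H: "pair_graph H" and V: "pverts G \<inter> pverts H = {r}"
    and profG: "pack_profile G r z1 y1 x1" and profH: "pack_profile H r z2 y2 x2"
  shows "pack_profile (graph_union G H) r (z1 + z2) (max (y1 + z2) (z1 + y2))
           (max (max (y1 + z2) (z1 + y2)) (x1 + x2 - 1))"
proof -
  let ?U = "graph_union G H"
  have r: "r \<in> pverts G" "r \<in> pverts H" using V by auto
  note fin = finite_pverts[OF G] finite_pverts[OF H]
  note boundsG = pack_profile_bounds[OF profG r(1)]
  note boundsH = pack_profile_bounds[OF profH r(2)]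
  have upperG: "card P \<le> x1" "r \<notin> P \<Longrightarrow> card P \<le> y1" "P \<inter> closed_nbhd G r = {} \<Longrightarrow> card P \<le> z1"
    if "packs G P" for P
    using that profG unfolding pack_profile_def by blast+
  have upperH: "card P \<le> x2" "r \<notin> P \<Longrightarrow> card P \<le> y2" "P \<inter> closed_nbhd H r = {} \<Longrightarrow> card P \<le> z2"
    if "packs H P" for P
    using that profH unfolding pack_profile_def by blast+
  have upper: "card P \<le> max (max (y1 + z2) (z1 + y2)) (x1 + x2 - 1) \<and>
      (r \<notin> P \<longrightarrow> card P \<le> max (y1 + z2) (z1 + y2)) \<and>
      (P \<inter> closed_nbhd ?U r = {} \<longrightarrow> card P \<le> z1 + z2)"
    if P: "packs ?U P" for P
  proof -
    have sub: "P \<subseteq> pverts G \<union> pverts H" using packs_within[OF P] by simp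
    then have card: "card (P \<inter> pverts G) + card (P \<inter> pverts H) = card P + (if r \<in> P then 1 else 0)"
      using V fin by (intro card_split_at) (auto intro: finite_subset)
    have PG: "packs G (P \<inter> pverts G)" using packs_graph_union_left[OF P] .
    have PH: "packs H (P \<inter> pverts H)"
      using packs_graph_union_left[of H G P] P by (simp add: graph_union_commute)
    show ?thesis
    proof (cases "r \<in> P")
      case True
      then show ?thesis using upperG(1)[OF PG] upperH(1)[OF PH] card by (auto simp: closed_nbhd_def)
    next
      case False
      have "P \<inter> pverts G \<inter> closed_nbhd G r = {} \<or> P \<inter> pverts H \<inter> closed_nbhd H r = {}"
      proof (rule ccontr)
        assume "\<not> ?thesis"
        then obtain u v where uv: "u \<in> P" "u \<in> pverts G" "u \<in> closed_nbhd G r"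
          "v \<in> P" "v \<in> pverts H" "v \<in> closed_nbhd H r" by blast
        then have "u = v"
          using packsD[OF P, of r u v] r by (simp add: closed_nbhd_graph_union)
        then have "u = r" using uv V by blast
        then show False using False uv by simp
      qed
      moreover have "P \<inter> pverts G \<inter> closed_nbhd G r = {}" "P \<inter> pverts H \<inter> closed_nbhd H r = {}"
        if "P \<inter> closed_nbhd ?U r = {}"
        using that unfolding closed_nbhd_graph_union by blast+
      ultimately show ?thesis
        using upperG(2,3)[OF PG] upperH(2,3)[OF PH] False card by auto
    qed
  qed
  obtain Z1 Y1 X1 where ZYX1: "packs G Z1" "Z1 \<inter> closed_nbhd G r = {}" "z1 \<le> card Z1"
    "packs G Y1" "r \<notin> Y1" "y1 \<le> card Y1" "packs G X1" "x1 \<le> card X1"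
    using profG unfolding pack_profile_def by blast
  obtain Z2 Y2 X2 where ZYX2: "packs H Z2" "Z2 \<inter> closed_nbhd H r = {}" "z2 \<le> card Z2"
    "packs H Y2" "r \<notin> Y2" "y2 \<le> card Y2" "packs H X2" "x2 \<le> card X2"
    using profH unfolding pack_profile_def by blast
  have notin: "r \<notin> Z1" "r \<notin> Z2"
    using ZYX1(2) ZYX2(2) closed_nbhd_self[of r G] closed_nbhd_self[of r H] by blast+
  have card_Un: "card (P \<union> Q) = card P + card Q" if "packs G P" "packs H Q" "r \<notin> P" for P Q
  proof (rule card_Un_disjoint)
    show "finite P" "finite Q" "P \<inter> Q = {}"
      using that packs_within[OF that(1)] packs_within[OF that(2)] fin V
      by (auto intro: finite_subset)
  qed
  have ZZ: "packs ?U (Z1 \<union> Z2)" "(Z1 \<union> Z2) \<inter> closed_nbhd ?U r = {}" "z1 + z2 \<le> card (Z1 \<union> Z2)"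
  proof -
    show "packs ?U (Z1 \<union> Z2)"
      using ZYX1(2) ZYX2(2) notin by (intro packs_join[OF G H V ZYX1(1) ZYX2(1)]) auto
    have "z = r" if "z \<in> Z1 \<and> z \<in> closed_nbhd H r \<or> z \<in> Z2 \<and> z \<in> closed_nbhd G r" for z
      using that packs_within[OF ZYX1(1)] packs_within[OF ZYX2(1)] V
        closed_nbhd_within[OF G r(1)] closed_nbhd_within[OF H r(2)] by blast
    then show "(Z1 \<union> Z2) \<inter> closed_nbhd ?U r = {}"
      using ZYX1(2) ZYX2(2) notin by (auto simp: closed_nbhd_graph_union)
    show "z1 + z2 \<le> card (Z1 \<union> Z2)"
      using card_Un[OF ZYX1(1) ZYX2(1) notin(1)] ZYX1(3) ZYX2(3) by simp
  qed
  have YZ: "packs ?U (Y1 \<union> Z2)" "y1 + z2 \<le> card (Y1 \<union> Z2)"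
    using ZYX1 ZYX2 notin card_Un[OF ZYX1(4) ZYX2(1)]
    by (auto intro!: packs_join[OF G H V ZYX1(4) ZYX2(1)])
  have ZY: "packs ?U (Z1 \<union> Y2)" "z1 + y2 \<le> card (Z1 \<union> Y2)"
    using ZYX1 ZYX2 notin card_Un[OF ZYX1(1) ZYX2(4)]
    by (auto intro!: packs_join[OF G H V ZYX1(1) ZYX2(4)])
  have Y: "\<exists>P. packs ?U P \<and> r \<notin> P \<and> max (y1 + z2) (z1 + y2) \<le> card P"
    using YZ ZY ZYX1(5) ZYX2(5) notin unfolding max_def
    by (cases "y1 + z2 \<le> z1 + y2") auto
  have X: "\<exists>P. packs ?U P \<and> x1 + x2 - 1 \<le> card P"
  proof (cases "r \<in> X1 \<and> r \<in> X2")
    case True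
    have "packs ?U (X1 \<union> X2)"
    proof (rule packs_join[OF G H V ZYX1(7) ZYX2(7)])
      show "r \<in> X1 \<longleftrightarrow> r \<in> X2" using True by simp
      fix u v assume "u \<in> X1 \<inter> closed_nbhd G r" "v \<in> X2 \<inter> closed_nbhd H r"
      then have "u = r" "v = r"
        using True packsD[OF ZYX1(7) r(1), of u r] packsD[OF ZYX2(7) r(2), of v r] by auto
      then show "u = v" by simp
    qed
    moreover have "x1 + x2 - 1 \<le> card (X1 \<union> X2)"
    proof -
      have finX: "finite X1" "finite X2"
        using packs_within[OF ZYX1(7)] packs_within[OF ZYX2(7)] fin by (auto intro: finite_subset)
      have "X1 \<inter> X2 \<subseteq> {r}"
        using packs_within[OF ZYX1(7)] packs_within[OF ZYX2(7)] V by blast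
      then have "card (X1 \<inter> X2) \<le> 1" using card_mono[of "{r}"] by fastforce
      then show ?thesis using card_Un_Int[OF finX] ZYX1(8) ZYX2(8) by linarith
    qed
    ultimately show ?thesis by blast
  next
    case False
    \<comment> \<open>on a side where an optimal packing avoids the root, the values with and without the root agree\<close>
    then have "x1 \<le> y1 \<or> x2 \<le> y2"
      using upperG(2)[OF ZYX1(7)] upperH(2)[OF ZYX2(7)] ZYX1(8) ZYX2(8) by linarith
    then have "x1 + x2 - 1 \<le> y1 + z2 \<or> x1 + x2 - 1 \<le> z1 + y2"
      using boundsG boundsH by linarith
    then show ?thesis using YZ ZY le_trans by blast
  qed
  show ?thesis
    unfolding pack_profile_def
  proof (intro conjI)
    show "\<exists>P. packs ?U P \<and> P \<inter> closed_nbhd ?U r = {} \<and> z1 + z2 \<le> card P"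
      using ZZ by blast
    show "\<exists>P. packs ?U P \<and> max (max (y1 + z2) (z1 + y2)) (x1 + x2 - 1) \<le> card P"
      using X Y unfolding max_def by (cases "max (y1 + z2) (z1 + y2) \<le> x1 + x2 - 1") (auto simp: max_def)
  qed (use upper Y in blast)+
qed

section \<open>Bridges\<close>

definition bridge ::
  "'a pair_pre_digraph \<Rightarrow> 'a \<Rightarrow> 'a \<Rightarrow> 'a pair_pre_digraph \<Rightarrow> 'a pair_pre_digraph" where
  "bridge G z y H = add_edge z y (graph_union G H)"

text \<open>
  The domination number is \<open>m\<close>, and it does not drop when the vertices of \<open>L\<close> are excused from
  being dominated. Taking for \<open>L\<close> all vertices at which a graph is attached to others makes
  this number additive.
\<close>

definition exempt_domination :: "'a pair_pre_digraph \<Rightarrow> 'a set \<Rightarrow> nat \<Rightarrow> bool" where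
  "exempt_domination G L m \<longleftrightarrow>
     (\<forall>D. covers G D (pverts G - L) \<longrightarrow> m \<le> card D) \<and> (\<exists>D. covers G D (pverts G) \<and> card D \<le> m)"

lemma exempt_domination_mono:
  assumes "exempt_domination G L m" "L' \<subseteq> L"
  shows "exempt_domination G L' m"
proof -
  have "covers G D (pverts G - L)" if "covers G D (pverts G - L')" for D
    using that assms(2) by (auto simp: covers_def)
  then show ?thesis using assms(1) unfolding exempt_domination_def by blast
qed

lemma exempt_domination_map_graph:
  assumes "inj f" "exempt_domination G L m"
  shows "exempt_domination (map_graph f G) (f ` L) m"
proof -
  have V: "pverts (map_graph f G) - f ` L = f ` (pverts G - L)"
    using assms(1) by (simp add: image_set_diff)
  show ?thesis
    unfolding exempt_domination_def V
  proof (intro conjI allI impI)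
    fix D assume D: "covers (map_graph f G) D (f ` (pverts G - L))"
    then obtain D0 where "D = f ` D0" using covers_image by blast
    then show "m \<le> card D"
      using D assms covers_map_graph[OF assms(1)] unfolding exempt_domination_def
      by (simp add: card_image_inj)
  next
    obtain D where "covers G D (pverts G)" "card D \<le> m"
      using assms(2) unfolding exempt_domination_def by blast
    then have "covers (map_graph f G) (f ` D) (f ` pverts G)" "card (f ` D) \<le> m"
      using covers_map_graph[OF assms(1)] card_image_inj[OF assms(1)] by auto
    then show "\<exists>D. covers (map_graph f G) D (pverts (map_graph f G)) \<and> card D \<le> m"
      unfolding pverts_simps by blast
  qed
qed

lemma exempt_domination_of_profile:
  "dom_profile G r m b a \<Longrightarrow> b = m \<Longrightarrow> exempt_domination G {r} m"
  unfolding dom_profile_def exempt_domination_def by blast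

text \<open>
  A constant packing profile is the dual of \<open>exempt_domination\<close>: the packing number is attained by
  a packing that stays away from the root.
\<close>

lemma pack_profile_const_iff:
  "pack_profile G r p p p \<longleftrightarrow>
     (\<forall>P. packs G P \<longrightarrow> card P \<le> p) \<and> (\<exists>P. packs G P \<and> P \<inter> closed_nbhd G r = {} \<and> p \<le> card P)"
proof -
  have "r \<notin> P" if "P \<inter> closed_nbhd G r = {}" for P
    using that closed_nbhd_self[of r G] by blast
  then show ?thesis unfolding pack_profile_def by blast
qed

lemma domination_number_eq:
  assumes "pair_graph G" "exempt_domination G L m"
  shows "domination_number G = m"
  unfolding domination_number_def
proof (rule Min_eqI)
  have "{D. dominating_set G D} \<subseteq> Pow (pverts G)" by (auto simp: dominating_set_def)
  then show "finite (card ` {D. dominating_set G D})"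
    using finite_pverts[OF assms(1)] by (meson finite_Pow_iff finite_imageI finite_subset)
  have lower: "m \<le> card D" if "dominating_set G D" for D
    using that exempt_domination_mono[OF assms(2), of "{}"]
    by (simp add: exempt_domination_def dominating_set_iff_covers)
  then show "m \<le> k" if "k \<in> card ` {D. dominating_set G D}" for k using that by blast
  obtain D where "dominating_set G D" "card D \<le> m"
    using assms(2) unfolding exempt_domination_def dominating_set_iff_covers by blast
  with lower have "dominating_set G D" "m = card D" by (auto intro: antisym)
  then show "m \<in> card ` {D. dominating_set G D}" by blast
qed

lemma packing_number_eq:
  assumes "pair_graph G" "pack_profile G r p p p"
  shows "packing_number G = p"
  unfolding packing_number_def packing_set_iff_packs[OF assms(1)]
proof (rule Max_eqI)
  have "{P. packs G P} \<subseteq> Pow (pverts G)" by (auto simp: packs_def)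
  then show "finite (card ` {P. packs G P})"
    using finite_pverts[OF assms(1)] by (meson finite_Pow_iff finite_imageI finite_subset)
  have upper: "card P \<le> p" if "packs G P" for P
    using that assms(2) by (simp add: pack_profile_const_iff)
  then show "k \<le> p" if "k \<in> card ` {P. packs G P}" for k using that by blast
  obtain P where "packs G P" "p \<le> card P"
    using assms(2) unfolding pack_profile_const_iff by blast
  with upper have "packs G P" "p = card P" by (auto intro: antisym)
  then show "p \<in> card ` {P. packs G P}" by blast
qed

text \<open>
  A bridge changes the closed neighbourhoods of its two ends only, so it is only through these that
  the two sides influence each other.
\<close>

context
  fixes G H :: "'a pair_pre_digraph" and z y :: 'a
  assumes G: "pair_graph G" and H: "pair_graph H"
    and disjoint: "pverts G \<inter> pverts H = {}"
    and z: "z \<in> pverts G" and y: "y \<in> pverts H"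
begin

lemma pverts_bridge: "pverts (bridge G z y H) = pverts G \<union> pverts H"
  using z y by (auto simp: bridge_def)

lemma pair_graph_bridge: "pair_graph (bridge G z y H)"
  unfolding bridge_def using G H disjoint z y by (intro pair_graph_intros) auto

lemma closed_nbhd_bridge_left:
  "v \<in> pverts G \<Longrightarrow> closed_nbhd (bridge G z y H) v = closed_nbhd G v \<union> (if v = z then {y} else {})"
proof -
  assume "v \<in> pverts G"
  then have "v \<notin> pverts H" "v \<noteq> y" using disjoint y by auto
  then show ?thesis
    using closed_nbhd_outside[OF H] closed_nbhd_self[of v G]
    by (auto simp: bridge_def closed_nbhd_add_edge closed_nbhd_graph_union)
qed

lemma closed_nbhd_bridge_right:
  "v \<in> pverts H \<Longrightarrow> closed_nbhd (bridge G z y H) v = closed_nbhd H v \<union> (if v = y then {z} else {})"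
proof -
  assume "v \<in> pverts H"
  then have "v \<notin> pverts G" "v \<noteq> z" using disjoint z by auto
  then show ?thesis
    using closed_nbhd_outside[OF G] closed_nbhd_self[of v H]
    by (auto simp: bridge_def closed_nbhd_add_edge closed_nbhd_graph_union)
qed

lemma card_Un_parts:
  assumes "X \<subseteq> pverts G" "Y \<subseteq> pverts H"
  shows "card (X \<union> Y) = card X + card Y"
proof (rule card_Un_disjoint)
  show "finite X" "finite Y" "X \<inter> Y = {}"
    using assms disjoint finite_pverts[OF G] finite_pverts[OF H] by (auto intro: finite_subset)
qed

text \<open>
  A dominating set restricts on each side to one that dominates all but the exempted
  vertices, since only \<open>z\<close> and \<open>y\<close> can be dominated across the bridge; hence the lower bound.
  Unions of dominating sets dominate.
\<close>

lemma exempt_domination_bridge: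
  assumes domG: "exempt_domination G L m" and domH: "exempt_domination H {y} n"
    and L: "z \<in> L" "L \<subseteq> pverts G"
  shows "exempt_domination (bridge G z y H) L (m + n)"
  unfolding exempt_domination_def
proof (intro conjI allI impI)
  let ?B = "bridge G z y H"
  fix D assume D: "covers ?B D (pverts ?B - L)"
  have "D \<inter> pverts G \<inter> closed_nbhd G v \<noteq> {}" if v: "v \<in> pverts G - L" for v
  proof -
    have "D \<inter> closed_nbhd ?B v \<noteq> {}" using D v pverts_bridge by (auto simp: covers_def)
    moreover have "closed_nbhd ?B v = closed_nbhd G v"
      using closed_nbhd_bridge_left[of v] v L(1) by auto
    ultimately show ?thesis using closed_nbhd_within[OF G, of v] v by auto
  qed
  then have "m \<le> card (D \<inter> pverts G)"
    using domG unfolding exempt_domination_def covers_def by auto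
  moreover have "D \<inter> pverts H \<inter> closed_nbhd H v \<noteq> {}" if v: "v \<in> pverts H - {y}" for v
  proof -
    have "v \<in> pverts ?B - L" using v pverts_bridge L(2) disjoint by blast
    then have "D \<inter> closed_nbhd ?B v \<noteq> {}" using D unfolding covers_def by blast
    moreover have "closed_nbhd ?B v = closed_nbhd H v"
      using closed_nbhd_bridge_right[of v] v by auto
    ultimately show ?thesis using closed_nbhd_within[OF H, of v] v by auto
  qed
  then have "n \<le> card (D \<inter> pverts H)"
    using domH unfolding exempt_domination_def covers_def by auto
  moreover have "D = (D \<inter> pverts G) \<union> (D \<inter> pverts H)"
    using D pverts_bridge by (auto simp: covers_def)
  ultimately show "m + n \<le> card D"
    using card_Un_parts[of "D \<inter> pverts G" "D \<inter> pverts H"] by simp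
next
  let ?B = "bridge G z y H"
  obtain D where D: "covers G D (pverts G)" "card D \<le> m"
    using domG unfolding exempt_domination_def by blast
  obtain E where E: "covers H E (pverts H)" "card E \<le> n"
    using domH unfolding exempt_domination_def by blast
  have "covers ?B (D \<union> E) (pverts ?B)"
    unfolding pverts_bridge unfolding bridge_def
    by (intro covers_add_edge covers_graph_union D(1) E(1))
  moreover have "card (D \<union> E) \<le> m + n"
    using card_Un_le[of D E] D(2) E(2) by simp
  ultimately show "\<exists>D. covers ?B D (pverts ?B) \<and> card D \<le> m + n" by blast
qed

text \<open>
  Choosing on the side of \<open>H\<close> an optimal packing that avoids the closed neighbourhood of \<open>y\<close> makes
  it compatible with every packing of \<open>G\<close>. As \<open>y\<close> is then unused, avoidance of the
  neighbourhood of \<open>x\<close> survives even when \<open>z = x\<close>, the case of the closure.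
\<close>

lemma pack_profile_bridge:
  assumes packG: "pack_profile G x p p p" and packH: "pack_profile H y q q q"
    and x: "x \<in> pverts G"
  shows "pack_profile (bridge G z y H) x (p + q) (p + q) (p + q)"
  unfolding pack_profile_const_iff
proof (intro conjI allI impI)
  let ?B = "bridge G z y H"
  fix P assume P: "packs ?B P"
  have U: "packs (graph_union G H) P"
    using packs_add_edge[OF P[unfolded bridge_def]] z y by simp
  have "card (P \<inter> pverts G) \<le> p"
    using packs_graph_union_left[OF U] packG by (simp add: pack_profile_const_iff)
  moreover have "card (P \<inter> pverts H) \<le> q"
    using packs_graph_union_left[of H G P] U packH
    by (simp add: pack_profile_const_iff graph_union_commute)
  moreover have "P = (P \<inter> pverts G) \<union> (P \<inter> pverts H)"
    using packs_within[OF P] pverts_bridge by auto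
  ultimately show "card P \<le> p + q"
    using card_Un_parts[of "P \<inter> pverts G" "P \<inter> pverts H"] by simp
next
  let ?B = "bridge G z y H"
  obtain P where P: "packs G P" "P \<inter> closed_nbhd G x = {}" "p \<le> card P"
    using packG unfolding pack_profile_const_iff by blast
  obtain Q where Q: "packs H Q" "Q \<inter> closed_nbhd H y = {}" "q \<le> card Q"
    using packH unfolding pack_profile_const_iff by blast
  have sub: "P \<subseteq> pverts G" "Q \<subseteq> pverts H" using packs_within P(1) Q(1) by auto
  have y_notin: "y \<notin> P \<union> Q"
    using sub(1) disjoint y Q(2) closed_nbhd_self[of y H] by blast
  have left: "s \<in> P \<and> s \<in> closed_nbhd G w"
    if s: "s \<in> P \<union> Q" "s \<in> closed_nbhd ?B w" and w: "w \<in> pverts G" for s w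
  proof -
    have "s \<noteq> y" using s(1) y_notin by blast
    then have "s \<in> closed_nbhd G w"
      using s(2) closed_nbhd_bridge_left[OF w] by (auto split: if_splits)
    then show ?thesis using s(1) closed_nbhd_within[OF G w] sub(2) disjoint by blast
  qed
  have right: "s \<in> Q \<and> s \<in> closed_nbhd H w"
    if s: "s \<in> P \<union> Q" "s \<in> closed_nbhd ?B w" and w: "w \<in> pverts H" "w \<noteq> y" for s w
  proof -
    have "s \<in> closed_nbhd H w"
      using s(2) closed_nbhd_bridge_right[OF w(1)] w(2) by simp
    then show ?thesis using s(1) closed_nbhd_within[OF H w(1)] sub(1) disjoint by blast
  qed
  \<comment> \<open>the one place where a vertex of the other side can intrude\<close>
  have at_y: "s = z" if s: "s \<in> P \<union> Q" "s \<in> closed_nbhd ?B y" for s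
  proof (rule ccontr)
    assume "s \<noteq> z"
    then have "s \<in> closed_nbhd H y"
      using s(2) closed_nbhd_bridge_right[OF y] by simp
    then show False using s(1) Q(2) closed_nbhd_within[OF H y] sub(1) disjoint by blast
  qed
  have "packs ?B (P \<union> Q)"
  proof (rule packsI)
    show "P \<union> Q \<subseteq> pverts ?B" using sub pverts_bridge by blast
    fix w u v
    assume w: "w \<in> pverts ?B" and uv: "u \<in> P \<union> Q" "v \<in> P \<union> Q"
      "u \<in> closed_nbhd ?B w" "v \<in> closed_nbhd ?B w"
    consider "w \<in> pverts G" | "w = y" | "w \<in> pverts H" "w \<noteq> y"
      using w pverts_bridge by auto
    then show "u = v"
    proof cases
      case 1
      then show ?thesis
        using left[OF uv(1,3)] left[OF uv(2,4)] packsD[OF P(1), of w u v] by simp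
    next
      case 2
      then show ?thesis using at_y[of u] at_y[of v] uv by simp
    next
      case 3
      then show ?thesis
        using right[OF uv(1,3)] right[OF uv(2,4)] packsD[OF Q(1), of w u v] by simp
    qed
  qed
  moreover have "(P \<union> Q) \<inter> closed_nbhd ?B x = {}"
    using left[OF _ _ x] P(2) by blast
  moreover have "p + q \<le> card (P \<union> Q)"
    using card_Un_parts[OF sub] P(3) Q(3) by simp
  ultimately show "\<exists>P. packs ?B P \<and> P \<inter> closed_nbhd ?B x = {} \<and> p + q \<le> card P" by blast
qed

end

section \<open>Connectedness, degrees and order\<close>

text \<open>
  The root degree is tracked separately by \<open>k\<close>, because the root is where further edges arrive. As
  \<open>closed_nbhd\<close> contains the vertex itself, its cardinality exceeds the degree by one.
\<close>

definition rooted_subcubic :: "'a pair_pre_digraph \<Rightarrow> 'a \<Rightarrow> nat \<Rightarrow> nat \<Rightarrow> bool" where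
  "rooted_subcubic G r n k \<longleftrightarrow> pair_graph G \<and> r \<in> pverts G \<and> card (pverts G) = n \<and>
     (\<forall>v \<in> pverts G. (r, v) \<in> (parcs G)\<^sup>*) \<and>
     card (closed_nbhd G r) \<le> k + 1 \<and> (\<forall>v \<in> pverts G - {r}. card (closed_nbhd G v) \<le> 4)"

text \<open>
  When a rooted graph is extended, joined, or hung below a connector, the new edges meet it at its
  root only. So a vertex of degree other than 3 that is not the root keeps its degree for good and
  certifies that the final graph is not cubic.
\<close>

definition deficient :: "'a pair_pre_digraph \<Rightarrow> 'a \<Rightarrow> bool" where
  "deficient G r \<longleftrightarrow> (\<exists>v \<in> pverts G - {r}. card (closed_nbhd G v) \<noteq> 4)"

lemma deficientI: "v \<in> pverts G \<Longrightarrow> v \<noteq> r \<Longrightarrow> card (closed_nbhd G v) \<noteq> 4 \<Longrightarrow> deficient G r"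
  by (auto simp: deficient_def)

lemma deficientE:
  assumes "deficient G r"
  obtains v where "v \<in> pverts G" "v \<noteq> r" "card (closed_nbhd G v) \<noteq> 4"
  using assms by (auto simp: deficient_def)

lemma card_closed_nbhd:
  assumes "pair_graph G"
  shows "card (closed_nbhd G v) = Suc (out_degree (with_proj G) v)"
proof -
  have "out_arcs (with_proj G) v = Pair v ` {u. (v, u) \<in> parcs G}"
    by (auto simp: out_arcs_def)
  then have "out_degree (with_proj G) v = card {u. (v, u) \<in> parcs G}"
    unfolding out_degree_def by (simp add: card_image inj_on_def)
  moreover have "v \<notin> {u. (v, u) \<in> parcs G}" "finite {u. (v, u) \<in> parcs G}"
    using assms finite_closed_nbhd[OF assms, of v]
    by (auto simp: pair_graph_iff closed_nbhd_def)
  ultimately show ?thesis by (simp add: closed_nbhd_def)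
qed

lemma rooted_subcubicD:
  assumes "rooted_subcubic G r n k"
  shows "pair_graph G" "r \<in> pverts G" "card (pverts G) = n"
    "\<And>v. v \<in> pverts G \<Longrightarrow> (r, v) \<in> (parcs G)\<^sup>*"
    "card (closed_nbhd G r) \<le> k + 1"
    "\<And>v. v \<in> pverts G \<Longrightarrow> v \<noteq> r \<Longrightarrow> card (closed_nbhd G v) \<le> 4"
  using assms by (simp_all add: rooted_subcubic_def)

lemma subcubic_of_rooted_subcubic:
  assumes "rooted_subcubic G r n 3"
  shows "subcubic G"
  unfolding subcubic_def
proof
  fix v assume "v \<in> pverts G"
  then have "card (closed_nbhd G v) \<le> 4"
    using rooted_subcubicD(5,6)[OF assms] by (cases "v = r") auto
  then show "out_degree (with_proj G) v \<le> 3"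
    using card_closed_nbhd[OF rooted_subcubicD(1)[OF assms]] by simp
qed

lemma connected_of_rooted_subcubic:
  assumes "rooted_subcubic G r n k"
  shows "Digraph_Component.connected (with_proj G)"
proof -
  interpret pair_graph G using rooted_subcubicD(1)[OF assms] .
  have from_root: "r \<rightarrow>\<^sup>*\<^bsub>with_proj G\<^esub> v" if "v \<in> pverts G" for v
    using rooted_subcubicD(4)[OF assms that]
  proof (induction rule: rtrancl_induct)
    case base
    then show ?case using rooted_subcubicD(2)[OF assms] by (simp add: reachable_refl)
  next
    case (step u w)
    then show ?case using reachable_adj_trans by auto
  qed
  have "strongly_connected (with_proj G)"
    unfolding strongly_connected_def
  proof (intro conjI ballI)
    show "verts (with_proj G) \<noteq> {}" using rooted_subcubicD(2)[OF assms] by auto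
    fix u v assume "u \<in> verts (with_proj G)" "v \<in> verts (with_proj G)"
    then show "u \<rightarrow>\<^sup>*\<^bsub>with_proj G\<^esub> v"
      using from_root[of u] from_root[of v] symmetric_reachable[OF sym_arcs] reachable_trans
      by (metis with_proj_simps(1))
  qed
  then show ?thesis
    unfolding Digraph_Component.connected_def strongly_connected_def
    by (auto intro: reachable_mk_symmetricI)
qed

lemma not_cubic_of_deficient:
  assumes "pair_graph G" "deficient G r"
  shows "\<not> cubic G"
  using assms(2) card_closed_nbhd[OF assms(1)] by (auto simp: deficient_def cubic_def)

lemma rooted_subcubic_map_graph:
  assumes f: "inj f" and G: "rooted_subcubic G r n k"
  shows "rooted_subcubic (map_graph f G) (f r) n k"
proof -
  have "(f r, f v) \<in> (parcs (map_graph f G))\<^sup>*" if "(r, v) \<in> (parcs G)\<^sup>*" for v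
    using that
  proof (induction rule: rtrancl_induct)
    case (step u w)
    then have "(f u, f w) \<in> parcs (map_graph f G)" by (force simp: map_graph_def)
    with step.IH show ?case by (rule rtrancl_into_rtrancl)
  qed simp
  then show ?thesis
    using G f unfolding rooted_subcubic_def
    by (auto simp: pair_graph_map_graph inj_on_subset card_image_inj closed_nbhd_map_graph inj_eq)
qed

lemma deficient_map_graph: "inj f \<Longrightarrow> deficient G r \<Longrightarrow> deficient (map_graph f G) (f r)"
  by (erule deficientE, rule_tac v = "f v" in deficientI)
    (auto simp: closed_nbhd_map_graph card_image_inj inj_eq)

lemma parcs_add_edge: "parcs (add_edge u v G) = parcs G \<union> {(u, v), (v, u)}"
  by (auto simp: graph_defs)

lemma parcs_graph_union: "parcs (graph_union G H) = parcs G \<union> parcs H"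
  by (simp add: graph_union_def)

lemma rooted_subcubic_pendant:
  assumes G: "rooted_subcubic G r n k" and "k \<le> 2" and p: "p \<notin> pverts G"
  shows "rooted_subcubic (add_edge p r G) p (n + 1) 1"
proof -
  note D = rooted_subcubicD[OF G]
  have "p \<noteq> r" using D(2) p by blast
  have V: "pverts (add_edge p r G) = insert p (pverts G)" using D(2) by auto
  have "(p, v) \<in> (parcs (add_edge p r G))\<^sup>*" if "v \<in> pverts G" for v
  proof -
    have "(p, r) \<in> parcs (add_edge p r G)" by (simp add: parcs_add_edge)
    moreover have "(r, v) \<in> (parcs (add_edge p r G))\<^sup>*"
      using D(4)[OF that] rtrancl_mono[of "parcs G" "parcs (add_edge p r G)"]
      by (auto simp: parcs_add_edge)
    ultimately show ?thesis by (rule converse_rtrancl_into_rtrancl)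
  qed
  moreover have "card (closed_nbhd (add_edge p r G) p) \<le> 2"
    using closed_nbhd_outside[OF D(1) p] \<open>p \<noteq> r\<close> by (simp add: closed_nbhd_add_edge)
  moreover have "card (closed_nbhd (add_edge p r G) v) \<le> 4" if "v \<in> pverts G" for v
  proof (cases "v = r")
    case True
    have "closed_nbhd (add_edge p r G) r = insert p (closed_nbhd G r)"
      using \<open>p \<noteq> r\<close> by (auto simp: closed_nbhd_add_edge)
    then show ?thesis
      using True D(5) \<open>k \<le> 2\<close> card_insert_le_m1[of 4 "closed_nbhd G r" p] by simp
  next
    case False
    then show ?thesis using D(6)[OF that] p that by (auto simp: closed_nbhd_add_edge)
  qed
  ultimately show ?thesis
    unfolding rooted_subcubic_def V
    using D(1,3) p \<open>p \<noteq> r\<close> finite_pverts[OF D(1)] by (auto intro: pair_graph_add_edge)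
qed

lemma deficient_pendant:
  assumes "deficient G r" "p \<notin> pverts G"
  shows "deficient (add_edge p r G) p"
proof -
  obtain v where v: "v \<in> pverts G" "v \<noteq> r" "card (closed_nbhd G v) \<noteq> 4"
    using assms(1) by (rule deficientE)
  then have "v \<noteq> p" using assms(2) by blast
  then show ?thesis using v by (intro deficientI[of v]) (auto simp: closed_nbhd_add_edge)
qed

lemma rooted_subcubic_join:
  assumes G: "rooted_subcubic G r n k" and H: "rooted_subcubic H r m l"
    and V: "pverts G \<inter> pverts H = {r}"
  shows "rooted_subcubic (graph_union G H) r (n + m - 1) (k + l)"
proof -
  note DG = rooted_subcubicD[OF G] and DH = rooted_subcubicD[OF H]
  note N = closed_nbhd_join[OF DG(1) DH(1) V]
  have "card (pverts G \<union> pverts H) + 1 = n + m"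
    using card_Un_Int[OF finite_pverts[OF DG(1)] finite_pverts[OF DH(1)]] DG(3) DH(3) V by simp
  moreover have "(r, v) \<in> (parcs (graph_union G H))\<^sup>*" if "v \<in> pverts G \<union> pverts H" for v
    using that DG(4)[of v] DH(4)[of v]
      rtrancl_mono[of "parcs G" "parcs (graph_union G H)"]
      rtrancl_mono[of "parcs H" "parcs (graph_union G H)"]
    by (auto simp: parcs_graph_union)
  moreover have "card (closed_nbhd (graph_union G H) r) \<le> k + l + 1"
  proof -
    have "r \<in> closed_nbhd G r \<inter> closed_nbhd H r" by simp
    then have "card (closed_nbhd G r \<inter> closed_nbhd H r) \<noteq> 0"
      using finite_closed_nbhd[OF DG(1), of r] by (auto simp del: closed_nbhd_self)
    then show ?thesis
      using card_Un_Int[OF finite_closed_nbhd[OF DG(1)] finite_closed_nbhd[OF DH(1)], of r r]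
        DG(5) DH(5) by (simp add: closed_nbhd_graph_union)
  qed
  moreover have "card (closed_nbhd (graph_union G H) v) \<le> 4"
    if "v \<in> pverts G \<union> pverts H" "v \<noteq> r" for v
    using that DG(6)[of v] DH(6)[of v] N[of v] by auto
  ultimately show ?thesis
    unfolding rooted_subcubic_def using DG(1,2) DH(1) by (auto intro: pair_graph_union)
qed

lemma deficient_join_right:
  assumes "pair_graph G" "pair_graph H" "pverts G \<inter> pverts H = {r}" "deficient H r"
  shows "deficient (graph_union G H) r"
proof -
  obtain v where v: "v \<in> pverts H" "v \<noteq> r" "card (closed_nbhd H v) \<noteq> 4"
    using assms(4) by (rule deficientE)
  then show ?thesis
    using closed_nbhd_join(2)[OF assms(1-3) v(1,2)] by (intro deficientI[of v]) auto
qed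

lemma rooted_subcubic_bridge:
  assumes G: "rooted_subcubic G x n k" and H: "rooted_subcubic H y m 2"
    and disjoint: "pverts G \<inter> pverts H = {}"
    and z: "z \<in> pverts G" "card (closed_nbhd G z) \<le> 3"
  shows "rooted_subcubic (bridge G z y H) x (n + m) (if z = x then k + 1 else k)"
proof -
  let ?B = "bridge G z y H"
  note DG = rooted_subcubicD[OF G] and DH = rooted_subcubicD[OF H]
  note ctxt = DG(1) DH(1) disjoint z(1) DH(2)
  note V = pverts_bridge[OF ctxt]
  note N = closed_nbhd_bridge_left[OF ctxt] closed_nbhd_bridge_right[OF ctxt]
  have arcs: "parcs ?B = parcs G \<union> parcs H \<union> {(z, y), (y, z)}"
    by (auto simp: bridge_def parcs_add_edge parcs_graph_union)
  have mono: "(parcs G)\<^sup>* \<subseteq> (parcs ?B)\<^sup>*" "(parcs H)\<^sup>* \<subseteq> (parcs ?B)\<^sup>*"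
    unfolding arcs by (rule rtrancl_mono, blast)+
  have "(x, v) \<in> (parcs ?B)\<^sup>*" if "v \<in> pverts ?B" for v
  proof (cases "v \<in> pverts G")
    case True
    then show ?thesis using DG(4) mono(1) by blast
  next
    case False
    then have "(y, v) \<in> (parcs ?B)\<^sup>*" using that V DH(4) mono(2) by blast
    moreover have "(z, y) \<in> parcs ?B" by (simp add: arcs)
    moreover have "(x, z) \<in> (parcs ?B)\<^sup>*" using DG(4)[OF z(1)] mono(1) by blast
    ultimately show ?thesis by (meson converse_rtrancl_into_rtrancl rtrancl_trans)
  qed
  moreover have "card (closed_nbhd ?B x) \<le> (if z = x then k + 1 else k) + 1"
    using N(1)[OF DG(2)] DG(5) card_insert_le_m1[of "k + 2" "closed_nbhd G x" y] by auto
  moreover have "card (closed_nbhd ?B v) \<le> 4" if "v \<in> pverts G" "v \<noteq> x" for v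
    using N(1)[OF that(1)] DG(6)[OF that] z(2) card_insert_le_m1[of 4 "closed_nbhd G z" y] by auto
  moreover have "card (closed_nbhd ?B v) \<le> 4" if "v \<in> pverts H" for v
    using N(2)[OF that] DH(5) DH(6)[OF that] card_insert_le_m1[of 4 "closed_nbhd H y" z] by auto
  moreover have "card (pverts ?B) = n + m"
    using V card_Un_parts[OF ctxt, of "pverts G" "pverts H"] DG(3) DH(3) by simp
  ultimately show ?thesis
    unfolding rooted_subcubic_def using pair_graph_bridge[OF ctxt] V DG(2) by auto
qed

lemma deficient_bridge_right:
  assumes "rooted_subcubic G x n k" "rooted_subcubic H y m l"
    and "pverts G \<inter> pverts H = {}" "z \<in> pverts G" "x \<in> pverts G" "deficient H y"
  shows "deficient (bridge G z y H) x"
proof -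
  note ctxt = rooted_subcubicD(1)[OF assms(1)] rooted_subcubicD(1)[OF assms(2)] assms(3,4)
    rooted_subcubicD(2)[OF assms(2)]
  obtain v where v: "v \<in> pverts H" "v \<noteq> y" "card (closed_nbhd H v) \<noteq> 4"
    using assms(6) by (rule deficientE)
  moreover have "v \<noteq> x" using v(1) assms(3,5) by blast
  ultimately show ?thesis
    using closed_nbhd_bridge_right[OF ctxt v(1)] pverts_bridge[OF ctxt]
    by (intro deficientI[of v]) auto
qed

section \<open>Rooted graph operations\<close>

definition profiled ::
  "rooted_graph \<Rightarrow> nat \<Rightarrow> nat \<Rightarrow> nat \<times> nat \<times> nat \<Rightarrow> nat \<times> nat \<times> nat \<Rightarrow> bool" where
  "profiled H n k = (\<lambda>(c, b, a) (z, y, x).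
     rooted_subcubic (graph_of H) (root_of H) n k \<and>
     dom_profile (graph_of H) (root_of H) c b a \<and> pack_profile (graph_of H) (root_of H) z y x)"

text \<open>
  The invariant of the recursion: an inert root, with domination number \<open>m\<close> and packing number \<open>p\<close>
  not affected by what happens at the root. Root degree at most 2 leaves room for one further edge.
\<close>

definition rigid :: "rooted_graph \<Rightarrow> nat \<Rightarrow> nat \<Rightarrow> nat \<Rightarrow> bool" where
  "rigid H n m p \<longleftrightarrow>
     rooted_subcubic (graph_of H) (root_of H) n 2 \<and>
     exempt_domination (graph_of H) {root_of H} m \<and>
     pack_profile (graph_of H) (root_of H) p p p \<and> deficient (graph_of H) (root_of H)"

lemma inj_Copy: "inj (Copy i)" and inj_Atom: "inj Atom"
  by (auto simp: inj_def)

lemma profiled_pendant: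
  assumes "profiled H n k (c, b, a) (z, y, x)" "k \<le> 2"
  shows "profiled (H\<^sup>\<up>) (n + 1) 1 (b, a, c + 1) (y, x, z + 1)"
proof -
  let ?G = "map_graph (Copy 0) (graph_of H)" and ?r = "Copy 0 (root_of H)"
  have S: "rooted_subcubic ?G ?r n k" and D: "dom_profile ?G ?r c b a"
    and P: "pack_profile ?G ?r z y x"
    using assms(1) unfolding profiled_def
    by (auto intro: rooted_subcubic_map_graph dom_profile_map_graph pack_profile_map_graph inj_Copy)
  have new: "Atom 0 \<notin> pverts ?G" by auto
  note G = rooted_subcubicD(1,2)[OF S]
  show ?thesis
    unfolding profiled_def pendant_def
    using rooted_subcubic_pendant[OF S assms(2) new] dom_profile_pendant[OF G new D]
      pack_profile_pendant[OF G new P] by simp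
qed

lemma deficient_pendant_root:
  "deficient (graph_of H) (root_of H) \<Longrightarrow> deficient (graph_of (H\<^sup>\<up>)) (root_of (H\<^sup>\<up>))"
  using deficient_pendant[OF deficient_map_graph[OF inj_Copy]] by (auto simp: pendant_def)

lemma join_parts_inter:
  assumes "root_of H \<in> pverts (graph_of H)" "root_of K \<in> pverts (graph_of K)"
  shows "pverts (map_graph (join_map 1 H) (graph_of H)) \<inter> pverts (map_graph (join_map 2 K) (graph_of K))
           = {Atom 0}"
  using assms by (auto simp: join_map_def)

lemma join_map_root [simp]: "join_map i H (root_of H) = Atom 0"
  by (simp add: join_map_def)

lemma profiled_join:
  assumes H: "profiled H n k (c1, b1, a1) (z1, y1, x1)"
    and K: "profiled K m l (c2, b2, a2) (z2, y2, x2)"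
  shows "profiled (H \<odot> K) (n + m - 1) (k + l)
    (min (c1 + c2) (a1 + a2 - 1), min (a1 + a2 - 1) (min (b1 + c2) (c1 + b2)), a1 + a2 - 1)
    (z1 + z2, max (y1 + z2) (z1 + y2), max (max (y1 + z2) (z1 + y2)) (x1 + x2 - 1))"
proof -
  let ?G = "map_graph (join_map 1 H) (graph_of H)" and ?K = "map_graph (join_map 2 K) (graph_of K)"
  have SH: "rooted_subcubic ?G (Atom 0) n k" and DH: "dom_profile ?G (Atom 0) c1 b1 a1"
    and PH: "pack_profile ?G (Atom 0) z1 y1 x1"
    using H rooted_subcubic_map_graph[OF inj_join_map, of "graph_of H" "root_of H" n k 1 H]
      dom_profile_map_graph[OF inj_join_map, of "graph_of H" "root_of H" c1 b1 a1 1 H]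
      pack_profile_map_graph[OF inj_join_map, of "graph_of H" "root_of H" z1 y1 x1 1 H]
    by (simp_all add: profiled_def)
  have SK: "rooted_subcubic ?K (Atom 0) m l" and DK: "dom_profile ?K (Atom 0) c2 b2 a2"
    and PK: "pack_profile ?K (Atom 0) z2 y2 x2"
    using K rooted_subcubic_map_graph[OF inj_join_map, of "graph_of K" "root_of K" m l 2 K]
      dom_profile_map_graph[OF inj_join_map, of "graph_of K" "root_of K" c2 b2 a2 2 K]
      pack_profile_map_graph[OF inj_join_map, of "graph_of K" "root_of K" z2 y2 x2 2 K]
    by (simp_all add: profiled_def)
  have V: "pverts ?G \<inter> pverts ?K = {Atom 0}"
    using join_parts_inter[of H K] H K by (simp add: profiled_def rooted_subcubic_def)
  note G = rooted_subcubicD(1)[OF SH] rooted_subcubicD(1)[OF SK] V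
  show ?thesis
    unfolding profiled_def rooted_join_def
    using rooted_subcubic_join[OF SH SK V] dom_profile_join[OF G DH DK] pack_profile_join[OF G PH PK]
    by simp
qed

lemma deficient_join_root:
  assumes "rooted H" "rooted K" "deficient (graph_of K) (root_of K)"
  shows "deficient (graph_of (H \<odot> K)) (root_of (H \<odot> K))"
proof -
  have "deficient (map_graph (join_map 2 K) (graph_of K)) (Atom 0)"
    using deficient_map_graph[OF inj_join_map assms(3), of 2 K] by simp
  moreover have pair: "pair_graph (map_graph (join_map i L) (graph_of L))" if "rooted L" for i L
    using that by (auto simp: rooted_def intro!: pair_graph_map_graph inj_join_map)
  moreover note join_parts_inter[of H K]
  ultimately have "deficient (graph_union (map_graph (join_map 1 H) (graph_of H))
      (map_graph (join_map 2 K) (graph_of K))) (Atom 0)"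
    using assms(1,2) unfolding rooted_def by (intro deficient_join_right) blast+
  then show ?thesis by (simp add: rooted_join_def)
qed

lemma rigid_of_profiled:
  "profiled H n 2 (m, m, a) (p, p, p) \<Longrightarrow> deficient (graph_of H) (root_of H) \<Longrightarrow> rigid H n m p"
  by (auto simp: profiled_def rigid_def intro: exempt_domination_of_profile)

text \<open>
  Attaching the two subtrees one after the other allows the bridge lemmas to be used twice.
\<close>

lemma compose_eq_bridges:
  "graph_of (compose K H1 H2) =
     bridge (bridge (map_graph (Copy 0) (graph_of K)) (Copy 0 (port2 K)) (Copy 2 (root_of H2))
               (map_graph (Copy 2) (graph_of H2)))
       (Copy 0 (port1 K)) (Copy 1 (root_of H1)) (map_graph (Copy 1) (graph_of H1))"
  by (auto simp: compose_def bridge_def graph_defs)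

lemma rigid_map_graph:
  assumes "rigid H n m p" "inj f"
  shows "rooted_subcubic (map_graph f (graph_of H)) (f (root_of H)) n 2"
    "exempt_domination (map_graph f (graph_of H)) {f (root_of H)} m"
    "pack_profile (map_graph f (graph_of H)) (f (root_of H)) p p p"
    "deficient (map_graph f (graph_of H)) (f (root_of H))"
  using assms exempt_domination_map_graph[OF assms(2), of "graph_of H" "{root_of H}" m]
  by (simp_all add: rigid_def rooted_subcubic_map_graph pack_profile_map_graph deficient_map_graph)

text \<open>
  The ports must be exempt as well as the root: they may be dominated by the subtrees. The subtrees
  contribute packings that stay away from their roots, which are compatible with every packing of
  the connector, even one that uses the ports.
\<close>

lemma rigid_compose:
  assumes K: "rooted_subcubic (graph_of K) (root_of K) n k" "k \<le> 2"
    and ports: "port1 K \<in> pverts (graph_of K)" "port2 K \<in> pverts (graph_of K)"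
      "port1 K \<noteq> port2 K" "port1 K \<noteq> root_of K" "port2 K \<noteq> root_of K"
      "card (closed_nbhd (graph_of K) (port1 K)) \<le> 3" "card (closed_nbhd (graph_of K) (port2 K)) \<le> 3"
    and dom: "exempt_domination (graph_of K) {root_of K, port1 K, port2 K} m"
    and pack: "pack_profile (graph_of K) (root_of K) p p p"
    and H1: "rigid H1 n1 m1 p1" and H2: "rigid H2 n2 m2 p2"
  shows "rigid (compose K H1 H2) (n + n1 + n2) (m + m1 + m2) (p + p1 + p2)"
proof -
  let ?K = "map_graph (Copy 0) (graph_of K)" and ?r = "Copy 0 (root_of K)"
  let ?z1 = "Copy 0 (port1 K)" and ?z2 = "Copy 0 (port2 K)"
  let ?H1 = "map_graph (Copy 1) (graph_of H1)" and ?x1 = "Copy 1 (root_of H1)"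
  let ?H2 = "map_graph (Copy 2) (graph_of H2)" and ?x2 = "Copy 2 (root_of H2)"
  let ?B = "bridge ?K ?z2 ?x2 ?H2"
  have SK: "rooted_subcubic ?K ?r n k" using rooted_subcubic_map_graph[OF inj_Copy K(1)] .
  have DK: "exempt_domination ?K {?r, ?z1, ?z2} m"
    using exempt_domination_map_graph[OF inj_Copy dom, of 0] by simp
  have PK: "pack_profile ?K ?r p p p" using pack_profile_map_graph[OF inj_Copy pack] .
  note R1 = rigid_map_graph[OF H1 inj_Copy[of 1]] and R2 = rigid_map_graph[OF H2 inj_Copy[of 2]]
  have zK: "?z1 \<in> pverts ?K" "?z2 \<in> pverts ?K" "?r \<in> pverts ?K"
    using ports(1,2) rooted_subcubicD(2)[OF K(1)] by auto
  have disj2: "pverts ?K \<inter> pverts ?H2 = {}" by auto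
  note ctxt2 = rooted_subcubicD(1)[OF SK] rooted_subcubicD(1)[OF R2(1)] disj2 zK(2)
    rooted_subcubicD(2)[OF R2(1)]
  have cards: "card (closed_nbhd ?K ?z1) \<le> 3" "card (closed_nbhd ?K ?z2) \<le> 3"
    using ports(6,7) by (simp_all add: closed_nbhd_map_graph inj_Copy card_image_inj)
  have SB: "rooted_subcubic ?B ?r (n + n2) k"
    using rooted_subcubic_bridge[OF SK R2(1) disj2 zK(2) cards(2)] ports(5) by simp
  \<comment> \<open>the ports stay exempt until both subtrees are attached\<close>
  have DB: "exempt_domination ?B {?r, ?z1, ?z2} (m + m2)"
    using exempt_domination_bridge[OF ctxt2 DK R2(2)] zK by simp
  have PB: "pack_profile ?B ?r (p + p2) (p + p2) (p + p2)"
    using pack_profile_bridge[OF ctxt2 PK R2(3) zK(3)] .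
  have VB: "pverts ?B = pverts ?K \<union> pverts ?H2" using pverts_bridge[OF ctxt2] .
  have disj1: "pverts ?B \<inter> pverts ?H1 = {}" unfolding VB by auto
  have zB: "?z1 \<in> pverts ?B" "?r \<in> pverts ?B" "{?r, ?z1, ?z2} \<subseteq> pverts ?B"
    using zK VB by auto
  note ctxt1 = rooted_subcubicD(1)[OF SB] rooted_subcubicD(1)[OF R1(1)] disj1 zB(1)
    rooted_subcubicD(2)[OF R1(1)]
  \<comment> \<open>attaching the subtree at the second port leaves the first port as it was\<close>
  have cardB: "card (closed_nbhd ?B ?z1) \<le> 3"
    using closed_nbhd_bridge_left[OF ctxt2 zK(1)] cards(1) ports(3) by simp
  let ?C = "bridge ?B ?z1 ?x1 ?H1"
  have "rooted_subcubic ?C ?r (n + n2 + n1) k"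
    using rooted_subcubic_bridge[OF SB R1(1) disj1 zB(1) cardB] ports(4) by simp
  then have "rooted_subcubic ?C ?r (n + n1 + n2) 2"
    using K(2) by (simp add: rooted_subcubic_def ac_simps)
  moreover have "exempt_domination ?C {?r, ?z1, ?z2} (m + m2 + m1)"
    using exempt_domination_bridge[OF ctxt1 DB R1(2) _ zB(3)] by simp
  then have "exempt_domination ?C {?r} (m + m1 + m2)"
    using exempt_domination_mono[of ?C "{?r, ?z1, ?z2}" _ "{?r}"] by (simp add: ac_simps)
  moreover have "pack_profile ?C ?r (p + p1 + p2) (p + p1 + p2) (p + p1 + p2)"
    using pack_profile_bridge[OF ctxt1 PB R1(3) zB(2)] by (simp add: ac_simps)
  moreover have "deficient ?C ?r"
    using deficient_bridge_right[OF SB R1(1) disj1 zB(1,2) R1(4)] .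
  moreover have "root_of (compose K H1 H2) = ?r" by (simp add: compose_def)
  ultimately show ?thesis
    unfolding rigid_def compose_eq_bridges by simp
qed

lemma closure_of_rigid:
  assumes "rigid H n m p"
  shows "Digraph_Component.connected (with_proj (closure_graph H))" "subcubic (closure_graph H)"
    "\<not> cubic (closure_graph H)" "card (pverts (closure_graph H)) = 2 * n"
    "domination_number (closure_graph H) = 2 * m" "packing_number (closure_graph H) = 2 * p"
proof -
  let ?H1 = "map_graph (Copy 1) (graph_of H)" and ?x1 = "Copy 1 (root_of H)"
  let ?H2 = "map_graph (Copy 2) (graph_of H)" and ?x2 = "Copy 2 (root_of H)"
  have C: "closure_graph H = bridge ?H1 ?x1 ?x2 ?H2"
    by (simp add: closure_graph_def bridge_def)
  note R1 = rigid_map_graph[OF assms inj_Copy[of 1]] and R2 = rigid_map_graph[OF assms inj_Copy[of 2]]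
  note D1 = rooted_subcubicD[OF R1(1)] and D2 = rooted_subcubicD[OF R2(1)]
  have disj: "pverts ?H1 \<inter> pverts ?H2 = {}" by auto
  note ctxt = D1(1) D2(1) disj D1(2) D2(2)
  have S: "rooted_subcubic (closure_graph H) ?x1 (n + n) 3"
    using rooted_subcubic_bridge[OF R1(1) R2(1) disj D1(2)] D1(5) unfolding C by simp
  have pg: "pair_graph (closure_graph H)" using rooted_subcubicD(1)[OF S] .
  show "Digraph_Component.connected (with_proj (closure_graph H))"
    using connected_of_rooted_subcubic[OF S] .
  show "subcubic (closure_graph H)" using subcubic_of_rooted_subcubic[OF S] .
  show "card (pverts (closure_graph H)) = 2 * n" using rooted_subcubicD(3)[OF S] by simp
  have "deficient (closure_graph H) ?x1"
    using deficient_bridge_right[OF R1(1) R2(1) disj D1(2,2) R2(4)] unfolding C .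
  then show "\<not> cubic (closure_graph H)" using not_cubic_of_deficient[OF pg] by blast
  have "exempt_domination (closure_graph H) {?x1} (m + m)"
    using exempt_domination_bridge[OF ctxt R1(2) R2(2)] D1(2) unfolding C by simp
  then show "domination_number (closure_graph H) = 2 * m"
    using domination_number_eq[OF pg] by simp
  have "pack_profile (closure_graph H) ?x1 (p + p) (p + p) (p + p)"
    using pack_profile_bridge[OF ctxt R1(3) R2(3) D1(2)] unfolding C .
  then show "packing_number (closure_graph H) = 2 * p"
    using packing_number_eq[OF pg] by simp
qed


section \<open>The seed and the connector\<close>

text \<open>
  The two explicit graphs on natural numbers, where finite checks reduce to arithmetic on
  numerals.
\<close>

definition seed_graph :: "nat pair_pre_digraph" where
  "seed_graph = edge_graph
      ({(1,2), (2,3), (3,4), (4,5), (5,6), (6,7), (7,8), (8,9), (9,1)}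
       \<union> {(2,6), (3,8), (4,7), (5,9)})"

definition connector_graph :: "nat pair_pre_digraph" where
  "connector_graph = edge_graph ({(1,2), (2,3), (3,4), (4,5), (5,1)} \<union> {(3,6), (5,6)})"

lemma pverts_seed_graph: "pverts seed_graph = {1, 2, 3, 4, 5, 6, 7, 8, 9}"
  by (auto simp: seed_graph_def)

lemma pverts_connector_graph: "pverts connector_graph = {1, 2, 3, 4, 5, 6}"
  by (auto simp: connector_graph_def)

lemma pair_graph_seed_graph: "pair_graph seed_graph"
  unfolding seed_graph_def by (rule pair_graph_edge_graph) auto

lemma pair_graph_connector_graph: "pair_graph connector_graph"
  unfolding connector_graph_def by (rule pair_graph_edge_graph) auto

lemma closed_nbhd_seed_graph:
  "closed_nbhd seed_graph 1 = {1, 2, 9}"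
  "closed_nbhd seed_graph 2 = {1, 2, 3, 6}"
  "closed_nbhd seed_graph 3 = {2, 3, 4, 8}"
  "closed_nbhd seed_graph 4 = {3, 4, 5, 7}"
  "closed_nbhd seed_graph 5 = {4, 5, 6, 9}"
  "closed_nbhd seed_graph 6 = {2, 5, 6, 7}"
  "closed_nbhd seed_graph 7 = {4, 6, 7, 8}"
  "closed_nbhd seed_graph 8 = {3, 7, 8, 9}"
  "closed_nbhd seed_graph 9 = {1, 5, 8, 9}"
  by (auto simp: closed_nbhd_def seed_graph_def edge_graph_def)

lemma closed_nbhd_connector_graph:
  "closed_nbhd connector_graph 1 = {1, 2, 5}"
  "closed_nbhd connector_graph 2 = {1, 2, 3}"
  "closed_nbhd connector_graph 3 = {2, 3, 4, 6}"
  "closed_nbhd connector_graph 4 = {3, 4, 5}"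
  "closed_nbhd connector_graph 5 = {1, 4, 5, 6}"
  "closed_nbhd connector_graph 6 = {3, 5, 6}"
  by (auto simp: closed_nbhd_def connector_graph_def edge_graph_def)

lemma rooted_subcubic_seed_graph: "rooted_subcubic seed_graph 1 9 2"
proof -
  have arcs: "(1, 2) \<in> parcs seed_graph" "(2, 3) \<in> parcs seed_graph" "(3, 4) \<in> parcs seed_graph"
    "(4, 5) \<in> parcs seed_graph" "(5, 6) \<in> parcs seed_graph" "(6, 7) \<in> parcs seed_graph"
    "(7, 8) \<in> parcs seed_graph" "(8, 9) \<in> parcs seed_graph"
    by (auto simp: seed_graph_def edge_graph_def)
  note step = rtrancl_into_rtrancl[of 1 _ "parcs seed_graph"]
  have "(1, 2) \<in> (parcs seed_graph)\<^sup>*" using arcs(1) by blast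
  moreover note step[OF this arcs(2)]
  moreover note step[OF this arcs(3)]
  moreover note step[OF this arcs(4)]
  moreover note step[OF this arcs(5)]
  moreover note step[OF this arcs(6)]
  moreover note step[OF this arcs(7)]
  moreover note step[OF this arcs(8)]
  ultimately have "\<forall>v \<in> pverts seed_graph. (1, v) \<in> (parcs seed_graph)\<^sup>*"
    unfolding pverts_seed_graph by blast
  moreover have "\<forall>v \<in> pverts seed_graph. card (closed_nbhd seed_graph v) \<le> 4"
    unfolding pverts_seed_graph by (simp add: closed_nbhd_seed_graph del: One_nat_def)
  moreover have "card (closed_nbhd seed_graph 1) \<le> 2 + 1"
    by (simp add: closed_nbhd_seed_graph del: One_nat_def)
  moreover have "card (pverts seed_graph) = 9" "1 \<in> pverts seed_graph"
    unfolding pverts_seed_graph by simp_all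
  ultimately show ?thesis
    unfolding rooted_subcubic_def using pair_graph_seed_graph by blast
qed

lemma rooted_subcubic_connector_graph: "rooted_subcubic connector_graph 1 6 2"
proof -
  have arcs: "(1, 2) \<in> parcs connector_graph" "(2, 3) \<in> parcs connector_graph"
    "(3, 4) \<in> parcs connector_graph" "(4, 5) \<in> parcs connector_graph" "(5, 6) \<in> parcs connector_graph"
    by (auto simp: connector_graph_def edge_graph_def)
  note step = rtrancl_into_rtrancl[of 1 _ "parcs connector_graph"]
  have "(1, 2) \<in> (parcs connector_graph)\<^sup>*" using arcs(1) by blast
  moreover note step[OF this arcs(2)]
  moreover note step[OF this arcs(3)]
  moreover note step[OF this arcs(4)]
  moreover note step[OF this arcs(5)]
  ultimately have "\<forall>v \<in> pverts connector_graph. (1, v) \<in> (parcs connector_graph)\<^sup>*"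
    unfolding pverts_connector_graph by blast
  moreover have "\<forall>v \<in> pverts connector_graph. card (closed_nbhd connector_graph v) \<le> 4"
    unfolding pverts_connector_graph by (simp add: closed_nbhd_connector_graph del: One_nat_def)
  moreover have "card (closed_nbhd connector_graph 1) \<le> 2 + 1"
    by (simp add: closed_nbhd_connector_graph del: One_nat_def)
  moreover have "card (pverts connector_graph) = 6" "1 \<in> pverts connector_graph"
    unfolding pverts_connector_graph by simp_all
  ultimately show ?thesis
    unfolding rooted_subcubic_def using pair_graph_connector_graph by blast
qed

lemma subset_pair_of_card_le_2:
  assumes "finite D" "card D \<le> 2" "D \<subseteq> V" "v0 \<in> V"
  shows "\<exists>u\<in>V. \<exists>v\<in>V. D \<subseteq> {u, v}"
proof -
  have "card D = 0 \<or> card D = 1 \<or> card D = 2" using assms(2) by linarith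
  then show ?thesis
  proof (elim disjE)
    assume "card D = 0"
    then show ?thesis using assms(1,4) by auto
  next
    assume "card D = 1"
    then show ?thesis using assms(3) by (auto simp: card_1_singleton_iff)
  next
    assume "card D = 2"
    then show ?thesis using assms(3) by (auto simp: card_2_iff)
  qed
qed

lemma card_le_1I:
  assumes "\<And>u v. u \<in> P \<Longrightarrow> v \<in> P \<Longrightarrow> u = v"
  shows "card P \<le> 1"
proof (cases "P = {}")
  case False
  then obtain u where "u \<in> P" by blast
  then have "P = {u}" using assms by blast
  then show ?thesis by simp
qed simp

text \<open>
  No two closed neighbourhoods cover the eight vertices other than the root, by inspection of all
  pairs, while \<open>{1, 3, 6}\<close> dominates everything and contains the root.
\<close>

lemma dom_profile_seed_graph: "dom_profile seed_graph 1 3 3 3"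
proof -
  have two_not_enough: "\<forall>u \<in> pverts seed_graph. \<forall>v \<in> pverts seed_graph.
      \<exists>w \<in> pverts seed_graph - {1}. u \<notin> closed_nbhd seed_graph w \<and> v \<notin> closed_nbhd seed_graph w"
    unfolding pverts_seed_graph by (simp add: closed_nbhd_seed_graph insert_Diff_if del: One_nat_def)
  have "3 \<le> card D" if D: "covers seed_graph D (pverts seed_graph - {1})" for D
  proof (rule ccontr)
    assume "\<not> 3 \<le> card D"
    moreover have "D \<subseteq> pverts seed_graph" using D by (simp add: covers_def)
    moreover from this have "finite D"
      using finite_pverts[OF pair_graph_seed_graph] finite_subset by blast
    moreover have "1 \<in> pverts seed_graph" by (simp add: pverts_seed_graph)
    ultimately obtain u v where uv: "u \<in> pverts seed_graph" "v \<in> pverts seed_graph" "D \<subseteq> {u, v}"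
      using subset_pair_of_card_le_2[of D "pverts seed_graph" 1] by auto
    then obtain w where "w \<in> pverts seed_graph - {1}"
      "u \<notin> closed_nbhd seed_graph w" "v \<notin> closed_nbhd seed_graph w"
      using two_not_enough by blast
    then show False using D uv(3) unfolding covers_def by blast
  qed
  moreover have "covers seed_graph {1, 3, 6} (pverts seed_graph)"
    unfolding covers_def pverts_seed_graph by (simp add: closed_nbhd_seed_graph del: One_nat_def)
  moreover from this have "covers seed_graph {1, 3, 6} (pverts seed_graph - {1})"
    by (simp add: covers_def)
  moreover have "card {1, 3, 6 :: nat} \<le> 3" by simp
  ultimately show ?thesis
    unfolding dom_profile_def by blast
qed

text \<open>
  Any two vertices other than the root lie in a common closed neighbourhood, so a packing has
  at most one of them. A packing of size 2 must therefore contain the root; one is \<open>{1, 4}\<close>.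
\<close>

lemma pack_profile_seed_graph: "pack_profile seed_graph 1 1 1 2"
proof -
  have near: "\<forall>u \<in> pverts seed_graph - {1}. \<forall>v \<in> pverts seed_graph - {1}.
      \<exists>w \<in> pverts seed_graph. u \<in> closed_nbhd seed_graph w \<and> v \<in> closed_nbhd seed_graph w"
    unfolding pverts_seed_graph by (simp add: closed_nbhd_seed_graph insert_Diff_if del: One_nat_def)
  have one: "card (P - {1}) \<le> 1" if P: "packs seed_graph P" for P
  proof (rule card_le_1I)
    fix u v assume uv: "u \<in> P - {1}" "v \<in> P - {1}"
    then obtain w where "w \<in> pverts seed_graph" "u \<in> closed_nbhd seed_graph w" "v \<in> closed_nbhd seed_graph w"
      using near packs_within[OF P] by blast
    then show "u = v" using packsD[OF P] uv by blast
  qed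
  have upper: "card P \<le> 2" "1 \<notin> P \<Longrightarrow> card P \<le> 1" "P \<inter> closed_nbhd seed_graph 1 = {} \<Longrightarrow> card P \<le> 1"
    if P: "packs seed_graph P" for P
  proof -
    show "card P \<le> 2" using one[OF P] diff_card_le_card_Diff[of "{1}" P] by simp
    show without_1: "card P \<le> 1" if "1 \<notin> P" using one[OF P] that by simp
    show "card P \<le> 1" if "P \<inter> closed_nbhd seed_graph 1 = {}"
      using without_1 that closed_nbhd_self[of 1 seed_graph] by blast
  qed
  have "packs seed_graph {3}" by (rule packs_singleton) (simp add: pverts_seed_graph)
  moreover have "{3} \<inter> closed_nbhd seed_graph 1 = {}"
    by (simp add: closed_nbhd_seed_graph del: One_nat_def)
  moreover have "packs seed_graph {1, 4}"
    unfolding packs_def pverts_seed_graph by (simp add: closed_nbhd_seed_graph del: One_nat_def)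
  moreover have "1 \<notin> {3 :: nat}" "1 \<le> card {3 :: nat}" "2 \<le> card {1, 4 :: nat}" by simp_all
  ultimately show ?thesis
    unfolding pack_profile_def using upper by blast
qed

text \<open>
  The vertices 2, 3 and 5 are neither root nor port, and no single vertex dominates all three; the
  pair \<open>{1, 3}\<close> dominates the whole connector.
\<close>

lemma exempt_domination_connector_graph: "exempt_domination connector_graph {1, 4, 6} 2"
proof -
  have one_not_enough: "\<forall>u \<in> pverts connector_graph. \<exists>w \<in> {2, 3, 5}. u \<notin> closed_nbhd connector_graph w"
    unfolding pverts_connector_graph by (simp add: closed_nbhd_connector_graph del: One_nat_def)
  have V: "pverts connector_graph - {1, 4, 6} = {2, 3, 5}"
    by (auto simp: pverts_connector_graph)
  have "2 \<le> card D" if D: "covers connector_graph D {2, 3, 5}" for D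
  proof (rule ccontr)
    assume "\<not> 2 \<le> card D"
    moreover have sub: "D \<subseteq> pverts connector_graph" using D by (simp add: covers_def)
    moreover from this have "finite D"
      using finite_pverts[OF pair_graph_connector_graph] finite_subset by blast
    moreover have "D \<noteq> {}" using D by (auto simp: covers_def)
    ultimately have "card D = 1" by (metis One_nat_def card_eq_0_iff less_2_cases not_le)
    then obtain u where "D = {u}" using card_1_singletonE by blast
    then show False using D sub one_not_enough unfolding covers_def by blast
  qed
  moreover have "covers connector_graph {1, 3} (pverts connector_graph)"
    unfolding covers_def pverts_connector_graph by (simp add: closed_nbhd_connector_graph del: One_nat_def)
  moreover have "card {1, 3 :: nat} \<le> 2" by simp
  ultimately show ?thesis
    unfolding exempt_domination_def V by blast
qed

text \<open>
  The connector has diameter 2, and the vertex 3 is at distance 2 from the root.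
\<close>

lemma pack_profile_connector_graph: "pack_profile connector_graph 1 1 1 1"
proof -
  have near: "\<forall>u \<in> pverts connector_graph. \<forall>v \<in> pverts connector_graph.
      \<exists>w \<in> pverts connector_graph. u \<in> closed_nbhd connector_graph w \<and> v \<in> closed_nbhd connector_graph w"
    unfolding pverts_connector_graph by (simp add: closed_nbhd_connector_graph del: One_nat_def)
  have "card P \<le> 1" if P: "packs connector_graph P" for P
  proof (rule card_le_1I)
    fix u v assume uv: "u \<in> P" "v \<in> P"
    then obtain w where "w \<in> pverts connector_graph"
      "u \<in> closed_nbhd connector_graph w" "v \<in> closed_nbhd connector_graph w"
      using near packs_within[OF P] by blast
    then show "u = v" using packsD[OF P] uv by blast
  qed
  moreover have "packs connector_graph {3}"
    by (rule packs_singleton) (simp add: pverts_connector_graph)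
  moreover have "{3} \<inter> closed_nbhd connector_graph 1 = {}"
    by (simp add: closed_nbhd_connector_graph del: One_nat_def)
  moreover have "1 \<le> card {3 :: nat}" by simp
  ultimately show ?thesis
    unfolding pack_profile_const_iff by blast
qed

lemma profiled_seed: "profiled seed_B 9 2 (3, 3, 3) (1, 1, 2)"
proof -
  have "graph_of seed_B = map_graph Atom seed_graph" "root_of seed_B = Atom 1"
    by (simp_all add: seed_B_def seed_graph_def)
  then show ?thesis
    unfolding profiled_def
    using rooted_subcubic_map_graph[OF inj_Atom rooted_subcubic_seed_graph]
      dom_profile_map_graph[OF inj_Atom dom_profile_seed_graph]
      pack_profile_map_graph[OF inj_Atom pack_profile_seed_graph] by simp
qed

lemma profiled_K1: "profiled K1 1 0 (0, 1, 1) (0, 0, 1)"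
proof -
  let ?G = "graph_of K1" and ?r = "Atom 0"
  have V: "pverts ?G = {?r}" and r: "root_of K1 = ?r" and N: "closed_nbhd ?G v = {v}" for v
    by (simp_all add: K1_def closed_nbhd_def)
  have pg: "pair_graph ?G" using rooted_K1 by (simp add: rooted_def)
  have covers: "covers ?G D W \<longleftrightarrow> D \<subseteq> {?r} \<and> W \<subseteq> D" for D W
    unfolding covers_def V N by blast
  have packs: "packs ?G P \<longleftrightarrow> P \<subseteq> {?r}" for P
    unfolding packs_def V N by blast
  have "rooted_subcubic ?G ?r 1 0"
    unfolding rooted_subcubic_def V N using pg by simp
  moreover have "dom_profile ?G ?r 0 1 1"
    unfolding dom_profile_def covers V N
  proof (intro conjI)
    show "\<exists>D. (D \<subseteq> {?r} \<and> {?r} - {?r} \<subseteq> D) \<and> card D \<le> 0" by (rule exI[of _ "{}"]) simp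
    show "\<exists>D. (D \<subseteq> {?r} \<and> {?r} \<subseteq> D) \<and> card D \<le> 1" by (rule exI[of _ "{?r}"]) simp
    show "\<exists>D. (D \<subseteq> {?r} \<and> {?r} \<subseteq> D) \<and> ?r \<in> D \<and> card D \<le> 1" by (rule exI[of _ "{?r}"]) simp
  qed (auto simp: subset_singleton_iff)
  moreover have "pack_profile ?G ?r 0 0 1"
    unfolding pack_profile_def packs N
  proof (intro conjI)
    show "\<exists>P. P \<subseteq> {?r} \<and> P \<inter> {?r} = {} \<and> 0 \<le> card P" by (rule exI[of _ "{}"]) simp
    show "\<exists>P. P \<subseteq> {?r} \<and> ?r \<notin> P \<and> 0 \<le> card P" by (rule exI[of _ "{}"]) simp
    show "\<exists>P. P \<subseteq> {?r} \<and> 1 \<le> card P" by (rule exI[of _ "{?r}"]) simp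
  qed (auto simp: subset_singleton_iff)
  ultimately show ?thesis by (simp add: profiled_def r)
qed

text \<open>
  The old vertex of \<open>K\<^sub>1\<close> becomes a leaf.
\<close>

lemma deficient_pendant_K1: "deficient (graph_of (K1\<^sup>\<up>)) (root_of (K1\<^sup>\<up>))"
proof (rule deficientI)
  show "Copy 0 (Atom 0) \<in> pverts (graph_of (K1\<^sup>\<up>))" by (simp add: pendant_def K1_def)
  show "Copy 0 (Atom 0) \<noteq> root_of (K1\<^sup>\<up>)" by (simp add: pendant_def)
  have "closed_nbhd (graph_of (K1\<^sup>\<up>)) (Copy 0 (Atom 0)) = {Copy 0 (Atom 0), Atom 0}"
    by (auto simp: pendant_def K1_def closed_nbhd_def graph_defs)
  then show "card (closed_nbhd (graph_of (K1\<^sup>\<up>)) (Copy 0 (Atom 0))) \<noteq> 4" by simp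
qed


section \<open>The recursive family\<close>

text \<open>
  The profiles are pushed through the construction. It is the interplay of the two branches that
  makes both profiles constant: neither \<open>(7, 7, 7)\<close>, \<open>(3, 3, 4)\<close> on the left nor \<open>(4, 4, 5)\<close>,
  \<open>(2, 2, 2)\<close> on the right has both constant.
\<close>

lemma rigid_Bstar_0: "rigid (Bstar 0) 32 11 5"
proof (rule rigid_of_profiled)
  have B: "profiled (seed_B\<^sup>\<up>) 10 1 (3, 3, 4) (1, 2, 2)"
    using profiled_pendant[OF profiled_seed] by (simp del: One_nat_def)
  have "profiled (seed_B\<^sup>\<bowtie>) 19 2 (6, 6, 7) (2, 3, 3)"
    using profiled_join[OF B B] by (simp add: bowtie_def del: One_nat_def)
  from profiled_pendant[OF this] have "profiled ((seed_B\<^sup>\<bowtie>)\<^sup>\<up>) 20 1 (6, 7, 7) (3, 3, 3)"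
    by (simp del: One_nat_def)
  from profiled_pendant[OF this] have left: "profiled (((seed_B\<^sup>\<bowtie>)\<^sup>\<up>)\<^sup>\<up>) 21 1 (7, 7, 7) (3, 3, 4)"
    by (simp del: One_nat_def)
  have "profiled (K1\<^sup>\<up>) 2 1 (1, 1, 1) (0, 1, 1)"
    using profiled_pendant[OF profiled_K1] by (simp del: One_nat_def)
  from profiled_join[OF B this] have "profiled (seed_B\<^sup>\<up> \<odot> K1\<^sup>\<up>) 11 2 (4, 4, 4) (1, 2, 2)"
    by (simp del: One_nat_def)
  from profiled_pendant[OF this] have "profiled (seed_B\<^sup>\<ltimes>) 12 1 (4, 4, 5) (2, 2, 2)"
    by (simp add: ltimes_def del: One_nat_def)
  from profiled_join[OF left this] show "profiled (Bstar 0) 32 2 (11, 11, 11) (5, 5, 5)"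
    by (simp del: One_nat_def)
  show "deficient (graph_of (Bstar 0)) (root_of (Bstar 0))"
    by (simp add: ltimes_def bowtie_def deficient_join_root deficient_pendant_root deficient_pendant_K1
        rooted_join rooted_pendant rooted_seed_B rooted_K1)
qed

lemma rigid_compose_A:
  assumes "rigid H n m p"
  shows "rigid (compose connector_A H H) (6 + n + n) (2 + m + m) (1 + p + p)"
proof -
  have A: "graph_of connector_A = map_graph Atom connector_graph" "root_of connector_A = Atom 1"
    "port1 connector_A = Atom 4" "port2 connector_A = Atom 6"
    by (simp_all add: connector_A_def connector_graph_def)
  show ?thesis
  proof (rule rigid_compose[OF _ order_refl _ _ _ _ _ _ _ _ _ assms assms])
    show "rooted_subcubic (graph_of connector_A) (root_of connector_A) 6 2"
      unfolding A by (rule rooted_subcubic_map_graph[OF inj_Atom rooted_subcubic_connector_graph])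
    show "exempt_domination (graph_of connector_A)
        {root_of connector_A, port1 connector_A, port2 connector_A} 2"
      using exempt_domination_map_graph[OF inj_Atom exempt_domination_connector_graph]
      unfolding A by simp
    show "pack_profile (graph_of connector_A) (root_of connector_A) 1 1 1"
      unfolding A by (rule pack_profile_map_graph[OF inj_Atom pack_profile_connector_graph])
  qed (simp_all add: A pverts_connector_graph closed_nbhd_map_graph[OF inj_Atom] card_image_inj[OF inj_Atom]
      closed_nbhd_connector_graph)
qed

text \<open>
  The closed forms solve \<open>n' = 2 * n + 6\<close>, \<open>m' = 2 * m + 2\<close> and \<open>p' = 2 * p + 1\<close> with initial values
  32, 11 and 5.
\<close>

lemma rigid_Bstar: "rigid (Bstar t) (38 * 2 ^ t - 6) (13 * 2 ^ t - 2) (6 * 2 ^ t - 1)"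
proof (induction t)
  case 0
  then show ?case using rigid_Bstar_0 by simp
next
  case (Suc t)
  have "(1 :: nat) \<le> 2 ^ t" by simp
  then have "6 + (38 * 2 ^ t - 6) + (38 * 2 ^ t - 6) = 38 * 2 ^ Suc t - (6 :: nat)"
    "2 + (13 * 2 ^ t - 2) + (13 * 2 ^ t - 2) = 13 * 2 ^ Suc t - (2 :: nat)"
    "1 + (6 * 2 ^ t - 1) + (6 * 2 ^ t - 1) = 6 * 2 ^ Suc t - (1 :: nat)"
    by (simp_all only: power_Suc)
  then show ?case using rigid_compose_A[OF Suc.IH] by (simp only: Bstar.simps)
qed

theorem theorem3p5:
  shows "(\<forall>t.
      Digraph_Component.connected (with_proj (Bhat t)) \<and> subcubic (Bhat t) \<and> \<not> cubic (Bhat t) \<and>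
      int (card (pverts (Bhat t))) = 76 * 2 ^ t - 12 \<and>
      int (domination_number (Bhat t)) = 26 * 2 ^ t - 4 \<and>
      int (packing_number (Bhat t)) = 12 * 2 ^ t - 2 \<and>
      int (domination_number (Bhat t)) - 2 * int (packing_number (Bhat t)) = 2 ^ (t + 1) \<and>
      real (domination_number (Bhat t)) / real (packing_number (Bhat t))
        = 13 / 6 + 1 / (36 * 2 ^ t - 6)) \<and>
    (\<lambda>t. real (domination_number (Bhat t)) / real (packing_number (Bhat t)))
      \<longlonglongrightarrow> 13 / 6"
proof -
  note Bhat = closure_of_rigid[OF rigid_Bstar, folded Bhat_def]
  have order: "int (card (pverts (Bhat t))) = 76 * 2 ^ t - 12"
    and dom: "int (domination_number (Bhat t)) = 26 * 2 ^ t - 4"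
    and pack: "int (packing_number (Bhat t)) = 12 * 2 ^ t - 2" for t
  proof -
    have "(1 :: nat) \<le> 2 ^ t" by simp
    then have "6 \<le> 38 * (2 :: nat) ^ t" "2 \<le> 13 * (2 :: nat) ^ t" "1 \<le> 6 * (2 :: nat) ^ t"
      by linarith+
    then have "int (38 * 2 ^ t - 6) = 38 * 2 ^ t - 6" "int (13 * 2 ^ t - 2) = 13 * 2 ^ t - 2"
      "int (6 * 2 ^ t - 1) = 6 * 2 ^ t - 1"
      by (simp_all only: of_nat_diff of_nat_mult of_nat_power of_nat_numeral of_nat_1)
    then show "int (card (pverts (Bhat t))) = 76 * 2 ^ t - 12"
      "int (domination_number (Bhat t)) = 26 * 2 ^ t - 4"
      "int (packing_number (Bhat t)) = 12 * 2 ^ t - 2"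
      unfolding Bhat(4-6) by simp_all
  qed
  have ratio: "real (domination_number (Bhat t)) / real (packing_number (Bhat t))
      = 13 / 6 + 1 / (36 * 2 ^ t - 6)" for t
  proof -
    have "real_of_int (int (domination_number (Bhat t))) = 26 * 2 ^ t - 4"
      "real_of_int (int (packing_number (Bhat t))) = 12 * 2 ^ t - 2"
      unfolding dom pack by simp_all
    moreover have "(1 :: real) \<le> 2 ^ t" by simp
    then have "12 * 2 ^ t - 2 \<noteq> (0 :: real)" "36 * 2 ^ t - 6 \<noteq> (0 :: real)" by linarith+
    then have "(26 * 2 ^ t - 4) / (12 * 2 ^ t - 2) = 13 / 6 + 1 / (36 * 2 ^ t - 6 :: real)"
      by (simp add: divide_simps) (simp add: algebra_simps)
    ultimately show ?thesis by simp
  qed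
  have "(\<lambda>t. 13 / 6 + 1 / (36 * 2 ^ t - 6) :: real) \<longlonglongrightarrow> 13 / 6"
    by real_asymp
  then have "(\<lambda>t. real (domination_number (Bhat t)) / real (packing_number (Bhat t)))
      \<longlonglongrightarrow> 13 / 6"
    unfolding ratio .
  moreover have "int (domination_number (Bhat t)) - 2 * int (packing_number (Bhat t)) = 2 ^ (t + 1)" for t
    unfolding dom pack by simp
  ultimately show ?thesis
    using Bhat(1-3) order dom pack ratio by blast
qed

end
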